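(* Let $k\geq 1$ and let $w=w(x_0,\ldots,x_k)$ be a cyclically reduced word in the free group on $x_0,\ldots,x_k$ which involves both $x_0$ and $x_k$. Suppose that the Magnus subgroups $\langle x_0,\ldots,x_{k-1}\rangle$ and $\langle x_1,\ldots,x_k\rangle$ do not have exceptional intersection in the one-relator group $\langle x_0,\ldots,x_k\mid w\rangle$. Then the cyclically presented group $G_n(w)$ is infinite for every integer $n\geq 4k$.
   Context: A word involves a generator $x_j$ if $x_j$ or $x_j^{-1}$ occurs in it. Let $\langle Y\mid r\rangle$ be a one-relator group with $r$ cyclically reduced. A subset $Y_1\subseteq Y$ is a Magnus subset if it omits a generator which appears in $r$; the subgroup $\langle Y_1\rangle$ is then called a Magnus subgroup and, by the Freiheitssatz, is free on $Y_1$. For two Magnus subgroups $M_1=\langle Y_1\rangle$, $M_2=\langle Y_2\rangle$ it is known (Collins) that $M_1\cap M_2$ is either the free group $F(Y_1\cap Y_2)$ on $Y_1\cap Y_2$, or the free product of $F(Y_1\cap Y_2)$ with an infinite cyclic group; in the latter case $M_1$ and $M_2$ are said to have exceptional intersection. Thus not having exceptional intersection means $M_1\cap M_2=\langle Y_1\cap Y_2\rangle$. For $n>k$, let $F_n$ be the free group on $x_0,\ldots,x_{n-1}$ and $\theta$ the automorphism of $F_n$ with $x_i\theta=x_{i+1}$ (subscripts mod $n$). Then $G_n(w)=F_n/N$, where $N$ is the normal closure of $\{w,w\theta,\ldots,w\theta^{n-1}\}$, i.e. $G_n(w)=\langle x_0,\ldots,x_{n-1}\mid w(x_i,\ldots,x_{i+k}),\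 0\leq i\leq n-1\rangle$ with subscripts mod $n$. *)

theory Defs
  imports "HOL-Algebra.Coset" "HOL-Algebra.Generated_Groups"
begin

section \<open>Words and free groups\<close>

text \<open>
  A letter is a generator together with a sign: \<open>(x, True)\<close> stands for \<open>x\<close> and
  \<open>(x, False)\<close> for its formal inverse.
\<close>

type_synonym 'a letter = "'a \<times> bool"

definition inv_letter :: "'a letter \<Rightarrow> 'a letter" where
  "inv_letter a = (fst a, \<not> snd a)"

definition involves :: "'a letter list \<Rightarrow> 'a \<Rightarrow> bool" where
  "involves w x \<longleftrightarrow> (x, True) \<in> set w \<or> (x, False) \<in> set w"

definition word_on :: "'a set \<Rightarrow> 'a letter list \<Rightarrow> bool" where
  "word_on X w \<longleftrightarrow> fst ` set w \<subseteq> X"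

definition reduced :: "'a letter list \<Rightarrow> bool" where
  "reduced w \<longleftrightarrow> successively (\<lambda>a b. b \<noteq> inv_letter a) w"

definition cyclically_reduced :: "'a letter list \<Rightarrow> bool" where
  "cyclically_reduced w \<longleftrightarrow> reduced w \<and> (w \<noteq> [] \<longrightarrow> hd w \<noteq> inv_letter (last w))"

text \<open>The reduced form of \<open>a # w\<close>, for reduced \<open>w\<close>.\<close>

fun push :: "'a letter \<Rightarrow> 'a letter list \<Rightarrow> 'a letter list" where
  "push a [] = [a]"
| "push a (b # w) = (if b = inv_letter a then w else a # b # w)"

text \<open>
  The free group on \<open>X\<close>: the reduced words on \<open>X\<close>, where the product of \<open>u\<close> and \<open>v\<close> is the
  reduced form of \<open>u @ v\<close>, obtained by pushing the letters of \<open>u\<close> onto \<open>v\<close> from right to left.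
\<close>

definition free_group :: "'a set \<Rightarrow> 'a letter list monoid" where
  "free_group X =
     \<lparr>carrier = {w. reduced w \<and> word_on X w}, mult = (\<lambda>u v. foldr push u v), one = []\<rparr>"

lemma inv_letter_simps [simp]:
  "inv_letter (inv_letter a) = a" "fst (inv_letter a) = fst a" "inv_letter a \<noteq> a"
  by (auto simp: inv_letter_def prod_eq_iff)

lemma inv_letter_eq_iff: "a = inv_letter b \<longleftrightarrow> b = inv_letter a"
  by (metis inv_letter_simps(1))

lemma reduced_Nil [simp]: "reduced []"
  by (simp add: reduced_def)

lemma reduced_Cons:
  "reduced (a # w) \<longleftrightarrow> reduced w \<and> (w \<noteq> [] \<longrightarrow> hd w \<noteq> inv_letter a)"
  by (cases w) (auto simp: reduced_def)

lemma reduced_push: "reduced w \<Longrightarrow> reduced (push a w)"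
  by (cases w) (auto simp: reduced_Cons)

lemma reduced_foldr_push: "reduced v \<Longrightarrow> reduced (foldr push u v)"
  by (induction u) (auto intro: reduced_push)

lemma push_eq_Cons: "reduced (a # w) \<Longrightarrow> push a w = a # w"
  by (cases w) (auto simp: reduced_Cons)

lemma push_inv: "reduced w \<Longrightarrow> push (inv_letter a) (push a w) = w"
  by (cases w) (auto simp: push_eq_Cons)

lemma foldr_push_push:
  assumes "reduced v" "reduced w"
  shows "foldr push (push a v) w = push a (foldr push v w)"
proof (cases "\<exists>u. v = inv_letter a # u")
  case True
  then obtain u where v: "v = inv_letter a # u" by blast
  have "push (inv_letter (inv_letter a)) (push (inv_letter a) (foldr push u w)) = foldr push u w"
    by (rule push_inv) (rule reduced_foldr_push[OF assms(2)])
  then show ?thesis by (simp add: v)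
next
  case False
  then have "push a v = a # v" by (cases v) auto
  then show ?thesis by simp
qed

lemma foldr_push_assoc:
  assumes "reduced v" "reduced w"
  shows "foldr push (foldr push u v) w = foldr push u (foldr push v w)"
  using assms by (induction u) (auto simp: foldr_push_push reduced_foldr_push)

lemma foldr_push_Nil: "reduced w \<Longrightarrow> foldr push w [] = w"
  by (induction w) (auto simp: reduced_Cons push_eq_Cons)

lemma word_on_simps [simp]:
  "word_on X []" "word_on X (a # w) \<longleftrightarrow> fst a \<in> X \<and> word_on X w"
  by (auto simp: word_on_def)

lemma word_on_push: "fst a \<in> X \<Longrightarrow> word_on X w \<Longrightarrow> word_on X (push a w)"
  by (cases w) auto

lemma word_on_foldr_push: "word_on X u \<Longrightarrow> word_on X v \<Longrightarrow> word_on X (foldr push u v)"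
  by (induction u) (auto intro: word_on_push)

lemma ex_left_inverse:
  "word_on X w \<Longrightarrow> \<exists>v. word_on X v \<and> reduced v \<and> foldr push v w = []" if "reduced w"
  using that
proof (induction w)
  case Nil
  show ?case by (intro exI[of _ "[]"]) simp
next
  case (Cons a w)
  then obtain v where v: "word_on X v" "reduced v" "foldr push v w = []"
    by (auto simp: reduced_Cons)
  let ?v = "foldr push v [inv_letter a]"
  have "foldr push ?v (a # w) = foldr push v (foldr push [inv_letter a] (a # w))"
    using Cons.prems by (intro foldr_push_assoc) (auto simp: reduced_Cons)
  also have "\<dots> = []" using v by simp
  finally have "foldr push ?v (a # w) = []" .
  moreover have "word_on X ?v" "reduced ?v"
    using v Cons.prems by (auto intro!: word_on_foldr_push reduced_foldr_push simp: reduced_Cons)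
  ultimately show ?case by blast
qed

lemma group_free_group: "group (free_group X)"
  by (rule groupI)
    (auto simp: free_group_def reduced_foldr_push word_on_foldr_push foldr_push_assoc
      dest: ex_left_inverse)


section \<open>Group presentations\<close>

definition normal_closure :: "('a, 'b) monoid_scheme \<Rightarrow> 'a set \<Rightarrow> 'a set" where
  "normal_closure G R = \<Inter>{N. N \<lhd> G \<and> R \<subseteq> N}"

definition presented_group :: "'a set \<Rightarrow> 'a letter list set \<Rightarrow> 'a letter list set monoid" where
  "presented_group X R = free_group X Mod normal_closure (free_group X) R"

definition presented_gen :: "'a set \<Rightarrow> 'a letter list set \<Rightarrow> 'a \<Rightarrow> 'a letter list set" where
  "presented_gen X R x =
     normal_closure (free_group X) R #>\<^bsub>free_group X\<^esub> [(x, True)]"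

text \<open>The subgroup \<open>\<langle>Y\<rangle>\<close> of \<open>\<langle>X | R\<rangle>\<close> generated by the (images of the) generators in \<open>Y\<close>.\<close>

definition presented_subgroup ::
    "'a set \<Rightarrow> 'a letter list set \<Rightarrow> 'a set \<Rightarrow> 'a letter list set set" where
  "presented_subgroup X R Y = generate (presented_group X R) (presented_gen X R ` Y)"

lemma (in group) normal_closure_normal:
  assumes "R \<subseteq> carrier G"
  shows "normal_closure G R \<lhd> G"
proof -
  have ne: "{N. N \<lhd> G \<and> R \<subseteq> N} \<noteq> {}"
    using assms normal_self by blast
  have "subgroup (normal_closure G R) G"
    unfolding normal_closure_def using ne
    by (intro subgroups_Inter) (auto dest: normal_imp_subgroup)
  then show ?thesis
    by (auto simp: normal_inv_iff) (auto simp: normal_closure_def normal_inv_iff)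
qed

lemma group_presented_group: "R \<subseteq> carrier (free_group X) \<Longrightarrow> group (presented_group X R)"
  unfolding presented_group_def
  by (intro normal.factorgroup_is_group group.normal_closure_normal group_free_group)


section \<open>Exceptional intersection of Magnus subgroups\<close>

text \<open>
  For Magnus subsets \<open>Y\<^sub>1, Y\<^sub>2\<close> of \<open>X\<close>, i.e. subsets omitting a generator that \<open>r\<close> involves, the
  intersection of \<open>M\<^sub>1 = \<langle>Y\<^sub>1\<rangle>\<close> and \<open>M\<^sub>2 = \<langle>Y\<^sub>2\<rangle>\<close> in the one-relator group \<open>\<langle>X | r\<rangle>\<close> is, by a theorem
  of Collins, either \<open>\<langle>Y\<^sub>1 \<inter> Y\<^sub>2\<rangle>\<close> or the free product of \<open>\<langle>Y\<^sub>1 \<inter> Y\<^sub>2\<rangle>\<close> with an infinite cyclic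
  group. The latter is the exceptional case, so the intersection is exceptional iff it differs
  from \<open>\<langle>Y\<^sub>1 \<inter> Y\<^sub>2\<rangle>\<close>.
\<close>

definition exceptional_intersection ::
    "'a set \<Rightarrow> 'a letter list \<Rightarrow> 'a set \<Rightarrow> 'a set \<Rightarrow> bool" where
  "exceptional_intersection X r Y\<^sub>1 Y\<^sub>2 \<longleftrightarrow>
     presented_subgroup X {r} Y\<^sub>1 \<inter> presented_subgroup X {r} Y\<^sub>2 \<noteq>
       presented_subgroup X {r} (Y\<^sub>1 \<inter> Y\<^sub>2)"


section \<open>Cyclically presented groups\<close>

text \<open>
  The automorphism \<open>x\<^sub>i \<mapsto> x\<^sub>i\<^sub>+\<^sub>1\<close> (subscripts mod \<open>n\<close>) of the free group on
  \<open>x\<^sub>0, \<dots>, x\<^sub>n\<^sub>-\<^sub>1\<close>, on reduced words; the generator \<open>x\<^sub>i\<close> is represented by \<open>i\<close>.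
\<close>

definition shift :: "nat \<Rightarrow> nat letter list \<Rightarrow> nat letter list" where
  "shift n = map (map_prod (\<lambda>i. (i + 1) mod n) id)"

definition cyc_pres_group :: "nat \<Rightarrow> nat letter list \<Rightarrow> nat letter list set monoid" where
  "cyc_pres_group n w = presented_group {..<n} ((\<lambda>i. (shift n ^^ i) w) ` {..<n})"

lemma bij_betw_Suc_mod: "bij_betw (\<lambda>i. (i + 1) mod n) {..<n} {..<(n::nat)}"
proof (cases "n = 0")
  case False
  have "inj_on (\<lambda>i. (i + 1) mod n) {..<n}"
  proof (rule inj_onI)
    fix i j assume ij: "i \<in> {..<n}" "j \<in> {..<n}" and "(i + 1) mod n = (j + 1) mod n"
    then show "i = j" by (auto simp: mod_Suc split: if_splits)
  qed
  moreover have "(\<lambda>i. (i + 1) mod n) ` {..<n} \<subseteq> {..<n}" using False by auto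
  ultimately show ?thesis
    by (simp add: bij_betw_def endo_inj_surj)
qed simp

lemma map_push:
  assumes "inj_on f (insert (fst a) (fst ` set w))"
  shows "map (map_prod f id) (push a w) = push (map_prod f id a) (map (map_prod f id) w)"
proof (cases w)
  case (Cons b v)
  have "f (fst b) = f (fst a) \<longleftrightarrow> fst b = fst a"
    using inj_on_eq_iff[OF assms, of "fst b" "fst a"] Cons by simp
  then show ?thesis using Cons
    by (cases a; cases b) (auto simp: inv_letter_def)
qed simp

lemma map_foldr_push:
  assumes "inj_on f X" "word_on X u" "word_on X v"
  shows "map (map_prod f id) (foldr push u v) =
    foldr push (map (map_prod f id) u) (map (map_prod f id) v)"
  using assms(2)
proof (induction u)
  case (Cons a u)
  have "word_on X (foldr push u v)"
    using Cons.prems assms(3) by (auto intro: word_on_foldr_push)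
  then have "insert (fst a) (fst ` set (foldr push u v)) \<subseteq> X"
    using Cons.prems by (simp add: word_on_def)
  then have "inj_on f (insert (fst a) (fst ` set (foldr push u v)))"
    using assms(1) inj_on_subset by blast
  from map_push[OF this] show ?case using Cons by (simp del: id_apply)
qed simp

lemma shift_iso: "shift n \<in> iso (free_group {..<n}) (free_group {..<n})"
proof -
  let ?f = "\<lambda>i. (i + 1) mod n"
  have inj: "inj_on ?f {..<n}" and img: "?f ` {..<n} = {..<n}"
    using bij_betw_Suc_mod[of n] by (auto simp: bij_betw_def)
  define g where "g = inv_into {..<n} ?f"
  have g: "inj_on g {..<n}" "g ` {..<n} \<subseteq> {..<n}"
    using inj_on_inv_into[of "{..<n}" ?f "{..<n}"] inv_into_into[of _ ?f "{..<n}"] img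
    unfolding g_def by blast+
  have gf: "g (?f i) = i" and fg: "?f (g i) = i" if "i < n" for i
    using that img inv_into_f_f[OF inj, of i] f_inv_into_f[of i ?f "{..<n}"]
    unfolding g_def by blast+
  have closed: "map (map_prod h id) u \<in> carrier (free_group {..<n})"
    if "inj_on h {..<n}" "h ` {..<n} \<subseteq> {..<n}" "u \<in> carrier (free_group {..<n})" for h u
  proof -
    have "foldr push (map (map_prod h id) u) [] = map (map_prod h id) u"
      using map_foldr_push[OF that(1), of u "[]"] that(3)
      by (simp add: free_group_def foldr_push_Nil)
    then have "reduced (map (map_prod h id) u)"
      by (metis reduced_Nil reduced_foldr_push)
    moreover have "word_on {..<n} (map (map_prod h id) u)"
      using that(2,3) by (fastforce simp: free_group_def word_on_def)
    ultimately show ?thesis by (simp add: free_group_def)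
  qed
  have "bij_betw (shift n) (carrier (free_group {..<n})) (carrier (free_group {..<n}))"
  proof (rule bij_betw_byWitness[where f' = "map (map_prod g id)"])
    show "\<forall>u\<in>carrier (free_group {..<n}). map (map_prod g id) (shift n u) = u"
      using gf by (fastforce simp: free_group_def word_on_def shift_def intro!: map_idI)
    show "\<forall>u\<in>carrier (free_group {..<n}). shift n (map (map_prod g id) u) = u"
      using fg by (fastforce simp: free_group_def word_on_def shift_def intro!: map_idI)
  qed (use closed inj img g in \<open>auto simp: shift_def\<close>)
  moreover have "shift n \<in> hom (free_group {..<n}) (free_group {..<n})"
  proof (rule homI)
    show "shift n u \<in> carrier (free_group {..<n})" if "u \<in> carrier (free_group {..<n})" for u
      using closed[OF inj _ that] img by (simp add: shift_def)
  qed (simp add: free_group_def shift_def map_foldr_push[OF inj, simplified])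
  ultimately show ?thesis by (simp add: iso_def)
qed

end

theory Submission
  imports Defs HOL.Rat "HOL-Library.Countable"
begin

text \<open>
  Cut the cycle of generators into the arcs \<open>{0..<k}\<close>, \<open>{k..<2k}\<close>, \<open>{2k..<3k}\<close> and the rest. The
  relators that start before \<open>2k\<close> define a group \<open>P\<close> on \<open>x\<^sub>0, \<dots>, x\<^bsub>3k-1\<^esub>\<close>, the others a group
  \<open>Q\<close>, and both share the two arcs \<open>A = {0..<k}\<close> and \<open>C = {2k..<3k}\<close>. By the Freiheitssatz \<open>P\<close>
  and \<open>Q\<close> are iterated amalgamated products of one-relator groups along free Magnus subgroups, and
  absence of exceptional intersection forces the generators of arcs with \<open>k\<close> or more relators
  between them to generate subgroups with trivial intersection. Splitting \<open>P\<close> (and \<open>Q\<close>) halfway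
  between the two arcs, the normal form theorem shows that \<open>A \<union> C\<close> freely generates a subgroup of
  each. Hence \<open>G\<^sub>n(w)\<close> is an amalgamated product of \<open>P\<close> and \<open>Q\<close> over a free group of rank
  \<open>2k\<close>, and it contains \<open>x\<^sub>0\<close> as an element of infinite order.

  The Freiheitssatz is proved by induction on the length of the relator. If the omitted generator
  \<open>t\<close> has nonzero exponent sum, the relator can be solved for \<open>t\<close> in groups of unitriangular
  rational matrices, which separate the elements of the free group on the remaining generators. If
  the exponent sum is zero, the conjugates \<open>t\<^sup>j x t\<^sup>-\<^sup>j\<close> satisfy shorter relators.
\<close>

section \<open>Words modulo relators\<close>

text \<open>Equality in the group presented by \<open>R\<close>; \<open>eqv {}\<close> is equality
  in the free group. No generating set is fixed: letters foreign to \<open>R\<close> only add free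
  factors, so one relation serves all generating sets.\<close>

inductive eqv :: "'a letter list set \<Rightarrow> 'a letter list \<Rightarrow> 'a letter list \<Rightarrow> bool" for R where
  eqv_refl [intro, simp]: "eqv R u u"
| eqv_sym: "eqv R u v \<Longrightarrow> eqv R v u"
| eqv_trans [trans]: "eqv R u v \<Longrightarrow> eqv R v w \<Longrightarrow> eqv R u w"
| eqv_cancel: "eqv R (u @ a # inv_letter a # v) (u @ v)"
| eqv_rel: "r \<in> R \<Longrightarrow> eqv R (u @ r @ v) (u @ v)"

definition free_on :: "'a set \<Rightarrow> 'a letter list set \<Rightarrow> bool" where
  "free_on Z R \<longleftrightarrow> (\<forall>u. word_on Z u \<longrightarrow> eqv R u [] \<longrightarrow> eqv {} u [])"

definition word_inv :: "'a letter list \<Rightarrow> 'a letter list" where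
  "word_inv u = rev (map inv_letter u)"

lemma word_on_append [simp]: "word_on X (u @ v) \<longleftrightarrow> word_on X u \<and> word_on X v"
  by (auto simp: word_on_def)

lemma word_on_word_inv [simp]: "word_on X (word_inv u) \<longleftrightarrow> word_on X u"
  by (auto simp: word_on_def word_inv_def image_image)

lemma word_on_mono: "word_on X u \<Longrightarrow> X \<subseteq> Y \<Longrightarrow> word_on Y u"
  by (auto simp: word_on_def)

lemma word_on_filter: "word_on X u \<Longrightarrow> word_on (X \<inter> Y) (filter (\<lambda>a. fst a \<in> Y) u)"
  by (auto simp: word_on_def)

definition rename :: "('a \<Rightarrow> 'b) \<Rightarrow> 'a letter list \<Rightarrow> 'b letter list" where
  "rename f u = map (\<lambda>a. (f (fst a), snd a)) u"

lemma rename_simps [simp]: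
  "rename f [] = []" "rename f (a # u) = (f (fst a), snd a) # rename f u"
  "rename f (u @ v) = rename f u @ rename f v"
  by (auto simp: rename_def)

lemma rename_rename: "rename f (rename g u) = rename (f \<circ> g) u"
  by (simp add: rename_def)

lemma length_rename [simp]: "length (rename f u) = length u"
  by (simp add: rename_def)

lemma word_on_rename: "word_on X (rename f u) \<longleftrightarrow> word_on (f -` X) u"
  by (induction u) auto

lemma rename_ident: "word_on X u \<Longrightarrow> (\<And>x. x \<in> X \<Longrightarrow> f x = x) \<Longrightarrow> rename f u = u"
  by (induction u) auto

lemma word_inv_simps [simp]:
  "word_inv [] = []" "word_inv (u @ v) = word_inv v @ word_inv u"
  "word_inv (a # u) = word_inv u @ [inv_letter a]" "word_inv (word_inv u) = u"
  by (auto simp: word_inv_def rev_map o_def)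

lemma eqv_mono: "eqv R u v \<Longrightarrow> R \<subseteq> S \<Longrightarrow> eqv S u v"
proof (induction rule: eqv.induct)
  case (eqv_rel r u v)
  then show ?case by (intro eqv.eqv_rel) auto
qed (rule eqv.eqv_refl | (rule eqv.eqv_sym, assumption) | (rule eqv.eqv_trans, assumption, assumption) |
  rule eqv.eqv_cancel)+

lemma eqv_context: "eqv R u v \<Longrightarrow> eqv R (p @ u @ q) (p @ v @ q)"
proof (induction rule: eqv.induct)
  case (eqv_cancel u a v)
  show ?case using eqv.eqv_cancel[of R "p @ u" a "v @ q"] by simp
next
  case (eqv_rel r u v)
  then show ?case using eqv.eqv_rel[of r R "p @ u" "v @ q"] by simp
qed (rule eqv.eqv_refl | (rule eqv.eqv_sym, assumption) | (rule eqv.eqv_trans, assumption, assumption))+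

lemma eqv_append: "eqv R u u' \<Longrightarrow> eqv R v v' \<Longrightarrow> eqv R (u @ v) (u' @ v')"
  using eqv_context[of R u u' "[]" v] eqv_context[of R v v' u' "[]"]
  by simp (rule eqv_trans)

lemma eqv_Cons: "eqv R v v' \<Longrightarrow> eqv R (a # v) (a # v')"
  using eqv_append[of R "[a]" "[a]" v v'] by simp

lemma eqv_word_inv_right: "eqv R (u @ word_inv u) []"
proof (induction u rule: rev_induct)
  case (snoc a u)
  then show ?case using eqv_cancel[of R u a "word_inv u"] by simp (erule (1) eqv_trans)
qed simp

lemma eqv_word_inv_left: "eqv R (word_inv u @ u) []"
  using eqv_word_inv_right[of R "word_inv u"] by simp

lemma eqv_cancel_left: "eqv R (z @ u) v \<longleftrightarrow> eqv R u (word_inv z @ v)"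
proof
  assume "eqv R (z @ u) v"
  then have "eqv R (word_inv z @ z @ u) (word_inv z @ v)" by (intro eqv_append) auto
  moreover have "eqv R (word_inv z @ z @ u) ([] @ u)"
    using eqv_append[OF eqv_word_inv_left[of R z] eqv_refl[of R u]] by simp
  ultimately show "eqv R u (word_inv z @ v)" by (metis append_Nil eqv_sym eqv_trans)
next
  assume "eqv R u (word_inv z @ v)"
  then have "eqv R (z @ u) (z @ word_inv z @ v)" by (intro eqv_append) auto
  moreover have "eqv R (z @ word_inv z @ v) ([] @ v)"
    using eqv_append[OF eqv_word_inv_right[of R z] eqv_refl[of R v]] by simp
  ultimately show "eqv R (z @ u) v" by (metis append_Nil eqv_trans)
qed

lemma eqv_cancel_right: "eqv R (u @ z) v \<longleftrightarrow> eqv R u (v @ word_inv z)"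
proof
  assume "eqv R (u @ z) v"
  then have "eqv R ((u @ z) @ word_inv z) (v @ word_inv z)" by (intro eqv_append) auto
  moreover have "eqv R (u @ z @ word_inv z) (u @ [])"
    using eqv_append[OF eqv_refl[of R u] eqv_word_inv_right[of R z]] by simp
  ultimately show "eqv R u (v @ word_inv z)" by (metis append_Nil2 append_assoc eqv_sym eqv_trans)
next
  assume "eqv R u (v @ word_inv z)"
  then have "eqv R (u @ z) ((v @ word_inv z) @ z)" by (intro eqv_append) auto
  moreover have "eqv R (v @ word_inv z @ z) (v @ [])"
    using eqv_append[OF eqv_refl[of R v] eqv_word_inv_left[of R z]] by simp
  ultimately show "eqv R (u @ z) v" by (metis append_Nil2 append_assoc eqv_trans)
qed

lemma eqv_iff_quotient_trivial: "eqv R u v \<longleftrightarrow> eqv R (u @ word_inv v) []"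
  using eqv_cancel_right[of R u "word_inv v" "[]"] by simp

lemma free_on_eqv:
  "free_on Z R \<Longrightarrow> word_on Z u \<Longrightarrow> word_on Z v \<Longrightarrow> eqv R u v \<Longrightarrow> eqv {} u v"
  using eqv_iff_quotient_trivial[of R u v] eqv_iff_quotient_trivial[of "{}" u v]
  by (simp add: free_on_def)

lemma free_on_mono: "free_on Z R \<Longrightarrow> Y \<subseteq> Z \<Longrightarrow> free_on Y R"
  by (auto simp: free_on_def intro: word_on_mono)

lemma eqv_rename: "eqv R u v \<Longrightarrow> eqv (rename f ` R) (rename f u) (rename f v)"
proof (induction rule: eqv.induct)
  case (eqv_cancel u a v)
  show ?case
    using eqv.eqv_cancel[of _ "rename f u" "(f (fst a), snd a)"] by (simp add: inv_letter_def)
next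
  case (eqv_rel r u v)
  then show ?case
    using eqv.eqv_rel[of "rename f r" "rename f ` R"] by simp
qed (rule eqv.eqv_refl | (rule eqv.eqv_sym, assumption) | (rule eqv.eqv_trans, assumption, assumption))+

text \<open>A left inverse of the renaming on \<open>X\<close> is itself a renaming, so no derivation has to be
  analysed.\<close>

lemma eqv_rename_iff:
  assumes "inj_on f X" "\<And>r. r \<in> R \<Longrightarrow> word_on X r" "word_on X u" "word_on X v"
  shows "eqv (rename f ` R) (rename f u) (rename f v) \<longleftrightarrow> eqv R u v"
proof
  let ?g = "rename (inv_into X f)"
  have gf: "?g (rename f x) = x" if "word_on X x" for x
    using rename_ident[OF that, of "inv_into X f \<circ> f"] assms(1) by (simp add: rename_rename)
  assume "eqv (rename f ` R) (rename f u) (rename f v)"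
  then have "eqv (?g ` rename f ` R) (?g (rename f u)) (?g (rename f v))" by (rule eqv_rename)
  moreover have "?g ` rename f ` R = R" using gf assms(2) by (force simp: image_image)
  ultimately show "eqv R u v" using gf assms by simp
qed (rule eqv_rename)

text \<open>Injectivity is asked for on \<open>X\<close> alone, so that reduction mod
  \<open>n\<close> can be applied to an arc of integers.\<close>

lemma free_on_rename:
  assumes "inj_on f X" "\<And>r. r \<in> R \<Longrightarrow> word_on X r" "Z \<subseteq> X" "free_on Z R"
  shows "free_on (f ` Z) (rename f ` R)"
  unfolding free_on_def
proof (intro allI impI)
  fix u assume u: "word_on (f ` Z) u" "eqv (rename f ` R) u []"
  define v where "v = rename (inv_into Z f) u"
  have uv: "u = rename f v"
    using rename_ident[OF u(1), of "f \<circ> inv_into Z f"]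
    by (simp add: v_def rename_rename f_inv_into_f)
  have v: "word_on Z v" unfolding v_def word_on_rename
    by (rule word_on_mono[OF u(1)]) (auto simp: inv_into_into)
  have "eqv R v []"
    using eqv_rename_iff[of f X R v "[]"] assms u(2) uv word_on_mono[OF v] by simp
  then have "eqv {} v []" using assms(4) v by (auto simp: free_on_def)
  from eqv_rename[OF this, of f] show "eqv {} u []" by (simp add: uv)
qed

text \<open>Deleting the letters outside \<open>X\<close> is the retraction of the free group that
  kills those generators.\<close>

lemma eqv_filter:
  "eqv {} u v \<Longrightarrow> eqv {} (filter (\<lambda>a. fst a \<in> X) u) (filter (\<lambda>a. fst a \<in> X) v)"
proof (induction rule: eqv.induct)
  case (eqv_cancel u a v)
  show ?case by (cases "fst a \<in> X") (auto intro: eqv.eqv_cancel)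
next
  case (eqv_rel r u v)
  then show ?case by simp
qed (rule eqv.eqv_refl | (rule eqv.eqv_sym, assumption) | (rule eqv.eqv_trans, assumption, assumption))+

text \<open>A derivation applies only finitely many relators. This confines a computation with
  infinitely many conjugates to a finite stretch of a chain.\<close>

lemma eqv_finitely_many_relators:
  "eqv R u v \<Longrightarrow> \<exists>S\<subseteq>R. finite S \<and> eqv S u v"
proof (induction rule: eqv.induct)
  case (eqv_sym u v)
  then show ?case using eqv.eqv_sym by blast
next
  case (eqv_trans u v w)
  then obtain S T where "S \<subseteq> R" "T \<subseteq> R" "finite S" "finite T" "eqv S u v" "eqv T v w" by blast
  then show ?case
    using eqv.eqv_trans[OF eqv_mono[of S u v "S \<union> T"] eqv_mono[of T v w "S \<union> T"]]
    by (intro exI[of _ "S \<union> T"]) auto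
next
  case (eqv_rel r u v)
  then show ?case by (intro exI[of _ "{r}"]) (auto intro: eqv.eqv_rel)
next
  case (eqv_cancel u a v)
  show ?case by (intro exI[of _ "{}"]) (simp add: eqv.eqv_cancel)
qed (intro exI[of _ "{}"], simp)

section \<open>Exponent sums and decomposition into syllables\<close>

definition exponent_sum :: "'a \<Rightarrow> 'a letter list \<Rightarrow> int" where
  "exponent_sum t u = (\<Sum>a\<leftarrow>u. if fst a = t then if snd a then 1 else -1 else 0)"

lemma exponent_sum_simps [simp]:
  "exponent_sum t [] = 0"
  "exponent_sum t (u @ v) = exponent_sum t u + exponent_sum t v"
  "exponent_sum t (a # u) =
    (if fst a = t then if snd a then 1 else -1 else 0) + exponent_sum t u"
  by (auto simp: exponent_sum_def)

lemma exponent_sum_eqv: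
  "eqv R u v \<Longrightarrow> (\<And>r. r \<in> R \<Longrightarrow> exponent_sum t r = 0) \<Longrightarrow> exponent_sum t u = exponent_sum t v"
  by (induction rule: eqv.induct) (auto simp: inv_letter_def)

lemma one_generator_trivial:
  assumes "word_on {x} u" "exponent_sum x u = 0"
  shows "eqv {} u []"
proof -
  \<comment> \<open>\<open>pw e\<close> is the power x^e as a reduced word; prepending a letter
    lengthens it or cancels its first letter, according to the signs.\<close>
  define pw where "pw e = replicate (nat \<bar>e\<bar>) (x, 0 \<le> e)" for e :: int
  have step: "eqv {} ((x, s) # pw e) (pw ((if s then 1 else -1) + e))" for s e
  proof -
    have cancel: "eqv {} ((x, s) # (x, \<not> s) # v) v" for s v
      using eqv_cancel[of "{}" "[]" "(x, s)" v] by (simp add: inv_letter_def)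
    consider "s" "e \<ge> 0" | "\<not> s" "e \<le> 0" | "s" "e < 0" | "\<not> s" "e > 0" by linarith
    then show ?thesis
    proof cases
      case 1
      then have "nat \<bar>1 + e\<bar> = Suc (nat \<bar>e\<bar>)" by simp
      with 1 show ?thesis by (simp add: pw_def)
    next
      case 2
      then have "nat \<bar>-1 + e\<bar> = Suc (nat \<bar>e\<bar>)" by simp
      with 2 show ?thesis by (cases "e = 0") (auto simp: pw_def)
    next
      case 3
      then have "nat \<bar>e\<bar> = Suc (nat \<bar>1 + e\<bar>)" by simp
      with 3 cancel[of True] show ?thesis by (cases "e = -1") (auto simp: pw_def)
    next
      case 4
      then have "nat \<bar>e\<bar> = Suc (nat \<bar>-1 + e\<bar>)" by simp
      with 4 cancel[of False] show ?thesis by (auto simp: pw_def)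
    qed
  qed
  have "eqv {} u (pw (exponent_sum x u))" using assms(1)
  proof (induction u)
    case Nil
    show ?case by (simp add: pw_def)
  next
    case (Cons a u)
    then have a: "a = (x, snd a)" by (simp add: prod_eq_iff)
    from Cons have "eqv {} (a # u) (a # pw (exponent_sum x u))" by (intro eqv_Cons) auto
    also have "eqv {} \<dots> (pw (exponent_sum x (a # u)))"
      using step[of "snd a" "exponent_sum x u"] a by (cases a) auto
    finally show ?case .
  qed
  then show ?thesis using assms(2) by (simp add: pw_def)
qed

definition alternating :: "('i \<times> 'b) list \<Rightarrow> bool" where
  "alternating gs \<longleftrightarrow> successively (\<lambda>g h. fst g \<noteq> fst h) gs"

lemma alternating_simps [simp]:
  "alternating []"
  "alternating (g # gs) \<longleftrightarrow> alternating gs \<and> (gs \<noteq> [] \<longrightarrow> fst g \<noteq> fst (hd gs))"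
  by (auto simp: alternating_def successively_Cons)

text \<open>Letters are added at the front. A first syllable that becomes trivial is dropped, and
  the rest is still alternating, so nothing has to be merged again. The sets \<open>U i\<close> are
  single generators in the Freiheitssatz and the two end arcs in \<open>ends_free\<close>.\<close>

lemma ex_alternating:
  assumes "word_on (\<Union>i\<in>I. U i) u"
  shows "\<exists>gs. alternating gs \<and> (\<forall>(i, g) \<in> set gs. i \<in> I \<and> word_on (U i) g \<and> \<not> eqv {} g []) \<and>
    eqv {} u (concat (map snd gs))"
  using assms
proof (induction u)
  case Nil
  show ?case by (intro exI[of _ "[]"]) simp
next
  case (Cons a u)
  then obtain gs i where gs: "alternating gs"
      "\<forall>(i, g) \<in> set gs. i \<in> I \<and> word_on (U i) g \<and> \<not> eqv {} g []"
      "eqv {} u (concat (map snd gs))" and i: "i \<in> I" "fst a \<in> U i"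
    by auto
  have au: "eqv {} (a # u) (a # concat (map snd gs))" using gs(3) by (rule eqv_Cons)
  show ?case
  proof (cases "gs \<noteq> [] \<and> fst (hd gs) = i")
    case True
    then obtain g hs where hs: "gs = (i, g) # hs" by (cases gs) auto
    show ?thesis
    proof (cases "eqv {} (a # g) []")
      case True
      from eqv_append[OF this eqv_refl[of _ "concat (map snd hs)"]] au
      have "eqv {} (a # u) (concat (map snd hs))" using eqv_trans by (simp add: hs) blast
      then show ?thesis using gs hs by (intro exI[of _ hs]) auto
    next
      case False
      then show ?thesis using gs hs i au by (intro exI[of _ "(i, a # g) # hs"]) auto
    qed
  next
    case diff: False
    show ?thesis
    proof (cases "eqv {} [a] []")
      case True
      from eqv_append[OF this eqv_refl[of _ "concat (map snd gs)"]] au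
      have "eqv {} (a # u) (concat (map snd gs))" using eqv_trans by simp blast
      then show ?thesis using gs by (intro exI[of _ gs]) auto
    next
      case False
      then show ?thesis using gs i au diff by (intro exI[of _ "(i, [a]) # gs"]) auto
    qed
  qed
qed

section \<open>Amalgamated products along free subgroups\<close>

text \<open>The union of the two presentations presents the amalgamated product: the shared
  generators are a basis of a free subgroup in each factor, so sharing their names identifies
  isomorphic subgroups.\<close>

locale amalgam =
  fixes X :: "bool \<Rightarrow> 'a set" and R :: "bool \<Rightarrow> 'a letter list set"
  assumes relators: "r \<in> R b \<Longrightarrow> word_on (X b) r"
    and free: "free_on (X True \<inter> X False) (R b)"
begin

section \<open>Coset representatives of the amalgamated subgroup\<close>

definition Z :: "'a set" where "Z = X True \<inter> X False"

definition in_Z :: "bool \<Rightarrow> 'a letter list \<Rightarrow> bool" where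
  "in_Z b a \<longleftrightarrow> (\<exists>z. word_on Z z \<and> eqv (R b) a z)"

text \<open>A representative of the coset \<open>Z a\<close> in factor \<open>b\<close>. The
  predicate under \<open>SOME\<close> depends only on the coset, which
  \<open>transversal_cong\<close> exploits; the trivial coset gets the empty word, so that an
  element of \<open>Z\<close> equals its \<open>Z_part\<close>.\<close>

definition transversal :: "bool \<Rightarrow> 'a letter list \<Rightarrow> 'a letter list" where
  "transversal b a = (if in_Z b a then []
    else SOME t. word_on (X b) t \<and> (\<exists>z. word_on Z z \<and> eqv (R b) a (z @ t)))"

text \<open>A choice of one word per element of the free group on \<open>Z\<close>, so that normal
  forms are compared by plain equality.\<close>

definition Z_normal :: "'a letter list \<Rightarrow> 'a letter list" where
  "Z_normal z = (SOME z'. word_on Z z' \<and> eqv {} z' z)"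

definition Z_part :: "bool \<Rightarrow> 'a letter list \<Rightarrow> 'a letter list" where
  "Z_part b a = Z_normal (SOME z. word_on Z z \<and> eqv (R b) a (z @ transversal b a))"

lemma Z_subset: "Z \<subseteq> X b"
  by (cases b) (auto simp: Z_def)

lemma word_on_Z: "word_on Z z \<Longrightarrow> word_on (X b) z"
  using word_on_mono[OF _ Z_subset] .

lemma free_Z: "word_on Z z \<Longrightarrow> word_on Z z' \<Longrightarrow> eqv (R b) z z' \<Longrightarrow> eqv {} z z'"
  using free_on_eqv free Z_def by metis

lemma eqv_free: "eqv {} u v \<Longrightarrow> eqv S u v"
  by (rule eqv_mono) auto

lemma Z_normal:
  assumes "word_on Z z"
  shows "word_on Z (Z_normal z)" "eqv {} (Z_normal z) z"
proof -
  have "\<exists>z'. word_on Z z' \<and> eqv {} z' z" using assms by blast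
  from someI_ex[OF this] show "word_on Z (Z_normal z)" "eqv {} (Z_normal z) z"
    by (auto simp: Z_normal_def)
qed

lemma Z_normal_cong: "eqv {} z z' \<Longrightarrow> Z_normal z = Z_normal z'"
  unfolding Z_normal_def by (metis eqv_sym eqv_trans)

lemma Z_normal_idem: "word_on Z z \<Longrightarrow> Z_normal (Z_normal z) = Z_normal z"
  by (rule Z_normal_cong) (rule Z_normal)

lemma in_Z_left:
  assumes "word_on Z z" "eqv (R b) a (z @ a')"
  shows "in_Z b a \<longleftrightarrow> in_Z b a'"
proof
  assume "in_Z b a"
  then obtain y where y: "word_on Z y" "eqv (R b) a y" by (auto simp: in_Z_def)
  then have "eqv (R b) (z @ a') y" using assms(2) by (metis eqv_sym eqv_trans)
  then show "in_Z b a'" using y assms by (auto simp: in_Z_def eqv_cancel_left intro: exI[of _ "word_inv z @ y"])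
next
  assume "in_Z b a'"
  then obtain y where y: "word_on Z y" "eqv (R b) a' y" by (auto simp: in_Z_def)
  then have "eqv (R b) a (z @ y)" using eqv_trans[OF assms(2) eqv_append[OF eqv_refl]] by blast
  then show "in_Z b a" using y assms unfolding in_Z_def by (intro exI[of _ "z @ y"]) auto
qed

lemma in_Z_right:
  assumes "word_on Z z"
  shows "in_Z b (a @ z) \<longleftrightarrow> in_Z b a"
proof
  assume "in_Z b (a @ z)"
  then obtain y where "word_on Z y" "eqv (R b) (a @ z) y" by (auto simp: in_Z_def)
  then show "in_Z b a" using assms unfolding in_Z_def eqv_cancel_right
    by (intro exI[of _ "y @ word_inv z"]) auto
next
  assume "in_Z b a"
  then obtain y where "word_on Z y" "eqv (R b) a y" by (auto simp: in_Z_def)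
  then show "in_Z b (a @ z)" using assms unfolding in_Z_def
    by (intro exI[of _ "y @ z"]) (auto intro: eqv_append)
qed

lemma in_Z_word: "word_on Z z \<Longrightarrow> in_Z b z"
  by (auto simp: in_Z_def)

lemma transversal_cong:
  assumes "word_on Z z" "eqv (R b) a (z @ a')"
  shows "transversal b a = transversal b a'"
proof -
  have a': "eqv (R b) a' (word_inv z @ a)"
    using assms(2) by (metis eqv_cancel_left eqv_sym)
  have "(\<exists>y. word_on Z y \<and> eqv (R b) a (y @ t)) \<longleftrightarrow> (\<exists>y. word_on Z y \<and> eqv (R b) a' (y @ t))" for t
  proof
    assume "\<exists>y. word_on Z y \<and> eqv (R b) a (y @ t)"
    then obtain y where "word_on Z y" "eqv (R b) a (y @ t)" by blast
    then show "\<exists>y. word_on Z y \<and> eqv (R b) a' (y @ t)"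
      using eqv_trans[OF a' eqv_append[OF eqv_refl]] assms(1)
      by (intro exI[of _ "word_inv z @ y"]) auto
  next
    assume "\<exists>y. word_on Z y \<and> eqv (R b) a' (y @ t)"
    then obtain y where "word_on Z y" "eqv (R b) a' (y @ t)" by blast
    then show "\<exists>y. word_on Z y \<and> eqv (R b) a (y @ t)"
      using eqv_trans[OF assms(2) eqv_append[OF eqv_refl]] assms(1)
      by (intro exI[of _ "z @ y"]) auto
  qed
  then show ?thesis using in_Z_left[OF assms] by (simp add: transversal_def)
qed

lemma transversal:
  assumes "word_on (X b) a"
  shows "word_on (X b) (transversal b a)"
    and "\<exists>z. word_on Z z \<and> eqv (R b) a (z @ transversal b a)"
proof -
  have "word_on (X b) (transversal b a) \<and> (\<exists>z. word_on Z z \<and> eqv (R b) a (z @ transversal b a))"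
  proof (cases "in_Z b a")
    case True
    then show ?thesis by (auto simp: transversal_def in_Z_def)
  next
    case False
    have "\<exists>t. word_on (X b) t \<and> (\<exists>z. word_on Z z \<and> eqv (R b) a (z @ t))"
      using assms by (intro exI[of _ a] conjI exI[of _ "[]"]) auto
    from someI_ex[OF this] show ?thesis using False by (simp add: transversal_def)
  qed
  then show "word_on (X b) (transversal b a)"
    "\<exists>z. word_on Z z \<and> eqv (R b) a (z @ transversal b a)" by blast+
qed

text \<open>The left factor in \<open>a = z t\<close> is unique in factor \<open>b\<close>; as
  \<open>Z\<close> is free there, it is unique in the free group, and \<open>Z_normal\<close> makes
  it unique as a word.\<close>

lemma Z_part_eqI:
  assumes "word_on Z z" "eqv (R b) a (z @ transversal b a)"
  shows "Z_part b a = Z_normal z"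
proof -
  define y where "y = (SOME z. word_on Z z \<and> eqv (R b) a (z @ transversal b a))"
  have y: "word_on Z y" "eqv (R b) a (y @ transversal b a)"
    using someI[of "\<lambda>z. word_on Z z \<and> eqv (R b) a (z @ transversal b a)" z] assms
    by (auto simp: y_def)
  have "eqv (R b) (y @ transversal b a) (z @ transversal b a)"
    using y(2) assms(2) by (metis eqv_sym eqv_trans)
  then have "eqv (R b) y ((z @ transversal b a) @ word_inv (transversal b a))"
    by (simp only: eqv_cancel_right)
  moreover have "eqv (R b) ((z @ transversal b a) @ word_inv (transversal b a)) z"
    using eqv_append[OF eqv_refl[of _ z] eqv_word_inv_right[of "R b" "transversal b a"]] by simp
  ultimately have "eqv (R b) y z" by (rule eqv_trans)
  from Z_normal_cong[OF free_Z[OF y(1) assms(1) this]] show ?thesis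
    by (simp add: Z_part_def y_def)
qed

lemma Z_part:
  assumes "word_on (X b) a"
  shows "word_on Z (Z_part b a)" "eqv (R b) a (Z_part b a @ transversal b a)"
    "Z_normal (Z_part b a) = Z_part b a"
proof -
  obtain z where z: "word_on Z z" "eqv (R b) a (z @ transversal b a)"
    using transversal(2)[OF assms] by blast
  note eq = Z_part_eqI[OF z]
  show "word_on Z (Z_part b a)" "Z_normal (Z_part b a) = Z_part b a"
    using Z_normal[OF z(1)] Z_normal_idem[OF z(1)] by (simp_all add: eq)
  have "eqv (R b) (z @ transversal b a) (Z_part b a @ transversal b a)"
    unfolding eq by (rule eqv_append[OF eqv_free[OF eqv_sym[OF Z_normal(2)[OF z(1)]]] eqv_refl])
  with z(2) show "eqv (R b) a (Z_part b a @ transversal b a)" by (rule eqv_trans)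
qed

lemma Z_part_left:
  assumes "word_on (X b) a'" "word_on Z z" "eqv (R b) a (z @ a')"
  shows "Z_part b a = Z_normal (z @ Z_part b a')"
proof (rule Z_part_eqI)
  show "word_on Z (z @ Z_part b a')" using Z_part(1)[OF assms(1)] assms(2) by simp
  have "eqv (R b) (z @ a') (z @ Z_part b a' @ transversal b a')"
    by (intro eqv_append eqv_refl Z_part(2) assms)
  with assms(3) have "eqv (R b) a (z @ Z_part b a' @ transversal b a')" by (rule eqv_trans)
  then show "eqv (R b) a ((z @ Z_part b a') @ transversal b a)"
    using transversal_cong[OF assms(2,3)] by simp
qed

lemma transversal_idem:
  assumes "word_on (X b) a"
  shows "transversal b (transversal b a) = transversal b a"
    "in_Z b (transversal b a) \<longleftrightarrow> in_Z b a"
  using transversal_cong[OF Z_part(1,2)[OF assms]] in_Z_left[OF Z_part(1,2)[OF assms]] by auto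

text \<open>The normal form \<open>(c, [(b\<^sub>1, t\<^sub>1), \<dots>])\<close> stands for the product \<open>c t\<^sub>1 t\<^sub>2 \<dots>\<close> with
  \<open>c\<close> in the amalgamated subgroup and transversal elements \<open>t\<^sub>i \<noteq> 1\<close> from alternating factors.
  The factor \<open>b\<close> acts on normal forms by left multiplication after \<open>absorb\<close> has moved a leading
  syllable from \<open>b\<close> into \<open>c\<close>.\<close>

definition syllables :: "(bool \<times> 'a letter list) list \<Rightarrow> bool" where
  "syllables ts \<longleftrightarrow> alternating ts \<and>
    (\<forall>(b, t) \<in> set ts. word_on (X b) t \<and> \<not> in_Z b t \<and> transversal b t = t)"

definition normal_form :: "'a letter list \<times> (bool \<times> 'a letter list) list \<Rightarrow> bool" where
  "normal_form s \<longleftrightarrow> word_on Z (fst s) \<and> Z_normal (fst s) = fst s \<and> syllables (snd s)"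

fun absorb :: "bool \<Rightarrow> 'a letter list \<times> (bool \<times> 'a letter list) list \<Rightarrow>
    'a letter list \<times> (bool \<times> 'a letter list) list" where
  "absorb b (c, (b', t) # ts) = (if b' = b then (c @ t, ts) else (c, (b', t) # ts))"
| "absorb b (c, []) = (c, [])"

text \<open>The opposite of \<open>absorb\<close>: an element of factor \<open>b\<close> is split
  again into its \<open>Z\<close> part and a transversal syllable, and an element of
  \<open>Z\<close> leaves no syllable.\<close>

fun emit :: "bool \<Rightarrow> 'a letter list \<times> (bool \<times> 'a letter list) list \<Rightarrow>
    'a letter list \<times> (bool \<times> 'a letter list) list" where
  "emit b (a, ts) = (Z_part b a, if in_Z b a then ts else (b, transversal b a) # ts)"

definition act :: "bool \<Rightarrow> 'a letter list \<Rightarrow> 'a letter list \<times> (bool \<times> 'a letter list) list \<Rightarrow>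
    'a letter list \<times> (bool \<times> 'a letter list) list" where
  "act b u s = emit b (u @ fst (absorb b s), snd (absorb b s))"

definition starts_with :: "bool \<Rightarrow> (bool \<times> 'a letter list) list \<Rightarrow> bool" where
  "starts_with b ts \<longleftrightarrow> ts \<noteq> [] \<and> fst (hd ts) = b"

lemma syllables_Cons:
  "syllables ((b, t) # ts) \<longleftrightarrow> syllables ts \<and> \<not> starts_with b ts \<and>
    word_on (X b) t \<and> \<not> in_Z b t \<and> transversal b t = t"
  by (auto simp: syllables_def starts_with_def)

lemma absorb:
  assumes "normal_form s"
  shows "word_on (X b) (fst (absorb b s))" "syllables (snd (absorb b s))"
    "\<not> starts_with b (snd (absorb b s))" "emit b (absorb b s) = s"
proof -
  obtain c ts where s: "s = (c, ts)" by (cases s)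
  have c: "word_on Z c" "Z_normal c = c" "syllables ts"
    using assms by (auto simp: normal_form_def s)
  have "word_on (X b) (fst (absorb b s)) \<and> syllables (snd (absorb b s)) \<and>
    \<not> starts_with b (snd (absorb b s)) \<and> emit b (absorb b s) = s"
  proof (cases "starts_with b ts")
    case True
    then obtain t ts' where ts: "ts = (b, t) # ts'" by (cases ts) (auto simp: starts_with_def)
    have t: "word_on (X b) t" "\<not> in_Z b t" "transversal b t = t" "\<not> starts_with b ts'"
        "syllables ts'"
      using c(3) by (auto simp: ts syllables_Cons)
    have tr: "transversal b (c @ t) = t" using transversal_cong[OF c(1) eqv_refl] t(3) by simp
    have "\<not> in_Z b (c @ t)" using in_Z_left[OF c(1) eqv_refl] t(2) by simp
    moreover have "Z_part b (c @ t) = c" using Z_part_eqI[OF c(1)] tr c(2) by simp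
    ultimately show ?thesis using t tr word_on_Z[OF c(1)] by (simp add: s ts)
  next
    case False
    then have ab: "absorb b s = s" by (cases ts) (auto simp: s starts_with_def)
    have inz: "in_Z b c" using c(1) by (rule in_Z_word)
    then have "Z_part b c = c" using Z_part_eqI[OF c(1)] c(2) by (simp add: transversal_def)
    then show ?thesis using c False inz word_on_Z[OF c(1)] by (simp add: ab) (simp add: s)
  qed
  then show "word_on (X b) (fst (absorb b s))" "syllables (snd (absorb b s))"
    "\<not> starts_with b (snd (absorb b s))" "emit b (absorb b s) = s" by blast+
qed

lemma emit:
  assumes "word_on (X b) a" "syllables ts" "\<not> starts_with b ts"
  shows "normal_form (emit b (a, ts))" "snd (absorb b (emit b (a, ts))) = ts"
    "eqv (R b) (fst (absorb b (emit b (a, ts)))) a"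
proof -
  note zp = Z_part[OF assms(1)] and tr = transversal(1)[OF assms(1)] transversal_idem[OF assms(1)]
  show "normal_form (emit b (a, ts))"
    using zp tr assms by (simp add: normal_form_def syllables_Cons)
  show "snd (absorb b (emit b (a, ts))) = ts"
    using assms(3) by (cases ts) (auto simp: starts_with_def)
  have "absorb b (x, ts) = (x, ts)" for x using assms(3) by (cases ts) (auto simp: starts_with_def)
  then show "eqv (R b) (fst (absorb b (emit b (a, ts)))) a"
    using eqv_sym[OF zp(2)] by (auto simp: transversal_def)
qed

lemma emit_cong:
  assumes "word_on (X b) a" "eqv (R b) a' a"
  shows "emit b (a', ts) = emit b (a, ts)"
proof -
  have e: "eqv (R b) a' ([] @ a)" using assms(2) by simp
  show ?thesis
    using Z_part_left[OF assms(1) _ e] Z_part[OF assms(1)] transversal_cong[OF _ e] in_Z_left[OF _ e]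
    by simp
qed

section \<open>Left multiplication as an action on normal forms\<close>

lemma normal_form_act: "normal_form s \<Longrightarrow> word_on (X b) u \<Longrightarrow> normal_form (act b u s)"
  unfolding act_def by (intro emit(1)) (auto simp: absorb)

text \<open>Between two multiplications \<open>absorb\<close> undoes \<open>emit\<close> up to the
  relators of factor \<open>b\<close>, and \<open>emit\<close> depends only on the element of the
  factor, so the two multiplications merge.\<close>

lemma act_append:
  assumes "normal_form s" "word_on (X b) u" "word_on (X b) v"
  shows "act b (u @ v) s = act b u (act b v s)"
proof -
  let ?a = "fst (absorb b s)" and ?ts = "snd (absorb b s)"
  note ab = absorb(1-3)[OF assms(1), of b]
  have va: "word_on (X b) (v @ ?a)" using assms(3) ab(1) by simp
  note em = emit[OF va ab(2,3)]
  have "act b u (act b v s) = emit b (u @ fst (absorb b (act b v s)), ?ts)"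
    using em(2) by (simp add: act_def del: emit.simps)
  also have "\<dots> = emit b (u @ v @ ?a, ?ts)"
    using em(3) assms(2) va by (intro emit_cong eqv_append) (auto simp: act_def)
  finally show ?thesis by (simp add: act_def)
qed

lemma act_Nil: "normal_form s \<Longrightarrow> act b [] s = s"
  using absorb(4)[of s b] by (simp add: act_def del: emit.simps)

lemma act_cong:
  assumes "normal_form s" "word_on (X b) v" "eqv (R b) u v"
  shows "act b u s = act b v s"
  unfolding act_def using assms absorb(1)[OF assms(1)]
  by (intro emit_cong eqv_append) auto

text \<open>The result does not mention \<open>b\<close>: the actions of the two factors agree on
  the amalgamated subgroup, where only the coefficient changes.\<close>

lemma act_Z:
  assumes "normal_form s" "word_on Z z"
  shows "act b z s = (Z_normal (z @ fst s), snd s)"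
proof -
  obtain a ts where ab: "absorb b s = (a, ts)" by (cases "absorb b s")
  have a: "word_on (X b) a" using absorb(1)[OF assms(1), of b] by (simp add: ab)
  have s: "s = emit b (a, ts)" using absorb(4)[OF assms(1), of b] by (simp add: ab)
  have "act b z s = emit b (z @ a, ts)" by (simp add: act_def ab)
  also have "\<dots> = (Z_normal (z @ Z_part b a), snd (emit b (a, ts)))"
    using Z_part_left[OF a assms(2) eqv_refl] transversal_cong[OF assms(2) eqv_refl]
      in_Z_left[OF assms(2) eqv_refl] by simp
  finally show ?thesis by (simp add: s)
qed

text \<open>For shared letters the order of the tests is immaterial by \<open>act_Z\<close>. Letters
  of neither factor act trivially, as they may occur in a derivation of \<open>eqv\<close>.\<close>

definition act_letter :: "'a letter \<Rightarrow> 'a letter list \<times> (bool \<times> 'a letter list) list \<Rightarrow>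
    'a letter list \<times> (bool \<times> 'a letter list) list" where
  "act_letter a = (if fst a \<in> X True then act True [a]
    else if fst a \<in> X False then act False [a] else (\<lambda>s. s))"

definition act_word :: "'a letter list \<Rightarrow> 'a letter list \<times> (bool \<times> 'a letter list) list \<Rightarrow>
    'a letter list \<times> (bool \<times> 'a letter list) list" where
  "act_word u = foldr act_letter u"

lemma act_letter:
  assumes "normal_form s" "fst a \<in> X b"
  shows "act_letter a s = act b [a] s"
proof (cases "b \<or> fst a \<notin> X True")
  case True
  then show ?thesis using assms(2) by (cases b) (auto simp: act_letter_def)
next
  case False
  then have "word_on Z [a]" using assms(2) by (auto simp: Z_def)
  from act_Z[OF assms(1) this] show ?thesis using False by (simp add: act_letter_def)
qed

lemma act_word:
  assumes "normal_form s" "word_on (X b) u"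
  shows "act_word u s = act b u s"
  using assms(2)
proof (induction u)
  case Nil
  then show ?case using assms(1) by (simp add: act_word_def act_Nil)
next
  case (Cons a u)
  then have "act_word (a # u) s = act_letter a (act b u s)" by (simp add: act_word_def)
  also have "\<dots> = act b [a] (act b u s)"
    using Cons.prems assms by (intro act_letter normal_form_act) auto
  also have "\<dots> = act b (a # u) s"
    using Cons.prems assms act_append[of s b "[a]" u] by simp
  finally show ?case .
qed

lemma act_word_append: "act_word (u @ v) s = act_word u (act_word v s)"
  by (simp add: act_word_def)

lemma normal_form_act_word:
  assumes "normal_form s"
  shows "normal_form (act_word u s)"
proof (induction u)
  case (Cons a u)
  then have "normal_form (act_letter a (act_word u s))"
    by (auto simp: act_letter_def intro!: normal_form_act)
  then show ?case by (simp add: act_word_def)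
qed (simp add: act_word_def assms)

text \<open>Every relator lies inside one factor, and every cancellation does so too or concerns
  letters that act trivially.\<close>

lemma act_word_eqv:
  assumes "eqv (R True \<union> R False) u v" "normal_form s"
  shows "act_word u s = act_word v s"
  using assms
proof (induction arbitrary: s rule: eqv.induct)
  case (eqv_cancel u a v)
  let ?s = "act_word v s" and ?aa = "[a, inv_letter a]"
  have nf: "normal_form ?s" using eqv_cancel by (rule normal_form_act_word)
  have "act_word ?aa ?s = ?s"
  proof (cases "\<exists>b. fst a \<in> X b")
    case True
    then obtain b where b: "word_on (X b) ?aa" by auto
    have "act_word ?aa ?s = act b ?aa ?s" using nf b by (rule act_word)
    also have "\<dots> = act b [] ?s"
      using eqv.eqv_cancel[of "R b" "[]" a "[]"] nf by (intro act_cong) auto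
    finally show ?thesis using nf by (simp add: act_Nil)
  next
    case False
    then show ?thesis by (simp add: act_word_def act_letter_def)
  qed
  then show ?case
    using act_word_append[of u "?aa @ v" s] act_word_append[of ?aa v s] act_word_append[of u v s]
    by simp
next
  case (eqv_rel r u v)
  let ?s = "act_word v s"
  have nf: "normal_form ?s" using eqv_rel(2) by (rule normal_form_act_word)
  obtain b where b: "r \<in> R b" using eqv_rel(1) by blast
  have "act_word r ?s = act b r ?s" using nf relators[OF b] by (rule act_word)
  also have "\<dots> = act b [] ?s"
    using eqv.eqv_rel[OF b, of "[]" "[]"] nf by (intro act_cong) auto
  finally show ?case using nf by (simp add: act_word_append act_Nil)
qed auto

section \<open>Embedding of the factors and the normal form theorem\<close>

definition base :: "'a letter list \<times> (bool \<times> 'a letter list) list" where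
  "base = (Z_normal [], [])"

lemma normal_form_base: "normal_form base"
  using Z_normal[of "[]"] Z_normal_idem[of "[]"]
  by (simp add: normal_form_def base_def syllables_def)

text \<open>A word of one factor sends the base point to the normal form of its own value there. If
  it fixes the base point, this value is 1.\<close>

theorem factor_embeds:
  assumes "word_on (X b) u" "eqv (R True \<union> R False) u []"
  shows "eqv (R b) u []"
proof -
  \<comment> \<open>The chosen word for 1 may be nonempty, but it is trivial in the free
    group.\<close>
  let ?c = "Z_normal []"
  have c: "word_on Z ?c" "eqv {} ?c []" using Z_normal[of "[]"] by auto
  have "base = act b u base"
    using act_word_eqv[OF assms(2) normal_form_base] act_word[OF normal_form_base assms(1)]
    by (simp add: act_word_def)
  also have "\<dots> = emit b (u @ ?c, [])" by (simp add: act_def base_def del: emit.simps)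
  finally have e: "Z_part b (u @ ?c) = ?c" "in_Z b (u @ ?c)"
    by (auto simp: base_def split: if_splits)
  have "word_on (X b) (u @ ?c)" using assms(1) word_on_Z[OF c(1)] by simp
  from Z_part(2)[OF this] have "eqv (R b) (u @ ?c) ?c" using e by (simp add: transversal_def)
  then have "eqv (R b) u (?c @ word_inv ?c)" by (simp add: eqv_cancel_right)
  then show ?thesis using eqv_word_inv_right by (rule eqv_trans)
qed

text \<open>Read from the right, each syllable meets a normal form that does not start in its
  factor. Multiplication by the coefficient from \<open>Z\<close> keeps it outside \<open>Z\<close>,
  so it contributes exactly one syllable.\<close>

lemma act_word_alternating:
  assumes "alternating gs" "\<forall>(b, g) \<in> set gs. word_on (X b) g \<and> \<not> in_Z b g"
  shows "map fst (snd (act_word (concat (map snd gs)) base)) = map fst gs"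
  using assms
proof (induction gs)
  case Nil
  then show ?case by (simp add: act_word_def base_def)
next
  case (Cons g gs)
  obtain b u where g: "g = (b, u)" by (cases g)
  let ?s = "act_word (concat (map snd gs)) base"
  obtain c ts where s: "?s = (c, ts)" by (cases ?s)
  have nf: "normal_form ?s" by (intro normal_form_act_word normal_form_base)
  have u: "word_on (X b) u" "\<not> in_Z b u" using Cons.prems by (auto simp: g)
  have IH: "map fst ts = map fst gs" using Cons s by simp
  have ns: "\<not> starts_with b ts"
    using Cons.prems(1) IH by (cases gs; cases ts) (auto simp: g starts_with_def)
  then have "absorb b (c, ts) = (c, ts)" by (cases ts) (auto simp: starts_with_def)
  moreover have "\<not> in_Z b (u @ c)" using u(2) in_Z_right nf by (simp add: normal_form_def s)
  ultimately have "snd (act b u (c, ts)) = (b, transversal b (u @ c)) # ts"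
    by (simp add: act_def)
  moreover have "act_word u ?s = act b u ?s" using nf u(1) by (rule act_word)
  ultimately show ?case using IH by (simp add: act_word_append g s)
qed

theorem alternating_nontrivial:
  assumes "alternating gs" "\<forall>(b, g) \<in> set gs. word_on (X b) g \<and> \<not> in_Z b g"
    "eqv (R True \<union> R False) (concat (map snd gs)) []"
  shows "gs = []"
  using act_word_alternating[OF assms(1,2)] act_word_eqv[OF assms(3) normal_form_base]
  by (simp add: act_word_def base_def)

text \<open>If neither word is in \<open>Z\<close>, then \<open>u\<close> times the inverse of
  \<open>v\<close> is alternating of length two, hence nontrivial. If \<open>v\<close> lies in
  \<open>Z\<close>, the comparison takes place in factor \<open>b\<close> by
  \<open>factor_embeds\<close>.\<close>

theorem factors_intersect:
  assumes "word_on (X b) u" "word_on (X (\<not> b)) v" "eqv (R True \<union> R False) u v"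
  shows "in_Z b u"
proof (rule ccontr)
  assume nu: "\<not> in_Z b u"
  show False
  proof (cases "in_Z (\<not> b) v")
    case True
    then obtain z where z: "word_on Z z" "eqv (R (\<not> b)) v z" by (auto simp: in_Z_def)
    have "eqv (R True \<union> R False) v z" using z(2) by (rule eqv_mono) (cases b, auto)
    with assms(3) have "eqv (R True \<union> R False) u z" by (rule eqv_trans)
    then have "eqv (R True \<union> R False) (u @ word_inv z) []" by (simp add: eqv_iff_quotient_trivial[symmetric])
    then have "eqv (R b) (u @ word_inv z) []"
      using assms(1) word_on_Z[OF z(1)] by (intro factor_embeds) auto
    then show False using nu z(1) by (auto simp: in_Z_def eqv_iff_quotient_trivial[symmetric])
  next
    case False
    have "in_Z (\<not> b) (word_inv v) \<Longrightarrow> in_Z (\<not> b) v"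
    proof -
      assume "in_Z (\<not> b) (word_inv v)"
      then obtain z where z: "word_on Z z" "eqv (R (\<not> b)) (word_inv v) z" by (auto simp: in_Z_def)
      then have "eqv (R (\<not> b)) [] (v @ z)"
        using eqv_cancel_left[of "R (\<not> b)" "word_inv v" "[]" z] by simp
      then have "eqv (R (\<not> b)) v (word_inv z)"
        using eqv_cancel_right[of "R (\<not> b)" v z "[]"] by (simp add: eqv_sym)
      then show ?thesis using z(1) by (auto simp: in_Z_def intro: exI[of _ "word_inv z"])
    qed
    then have "[(b, u), (\<not> b, word_inv v)] = []"
      using nu False assms by (intro alternating_nontrivial) (auto simp: eqv_iff_quotient_trivial[symmetric])
    then show False by simp
  qed
qed

end

section \<open>Equations over unitriangular matrices\<close>

text \<open>With infinite size all products are still finite sums, and one ring serves words of any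
  length; truncation happens modulo \<open>level K\<close>.\<close>

typedef triangular = "{f :: nat \<Rightarrow> nat \<Rightarrow> rat. \<forall>i j. j < i \<longrightarrow> f i j = 0}"
  morphisms entry Triangular
  by (rule exI[of _ "\<lambda>_ _. 0"]) simp

setup_lifting type_definition_triangular

lemma entry_below [simp]: "j < i \<Longrightarrow> entry A i j = 0"
  using entry[of A] by simp

lemma triangular_eqI: "(\<And>i j. i \<le> j \<Longrightarrow> entry A i j = entry B i j) \<Longrightarrow> A = B"
  by (metis entry_below entry_inject ext linorder_le_less_linear)

instantiation triangular :: ring_1
begin

lift_definition zero_triangular :: triangular is "\<lambda>_ _. 0" by simp
lift_definition one_triangular :: triangular is "\<lambda>i j. if i = j then 1 else 0" by simp
lift_definition plus_triangular :: "triangular \<Rightarrow> triangular \<Rightarrow> triangular"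
  is "\<lambda>A B i j. A i j + B i j" by simp
lift_definition minus_triangular :: "triangular \<Rightarrow> triangular \<Rightarrow> triangular"
  is "\<lambda>A B i j. A i j - B i j" by simp
lift_definition uminus_triangular :: "triangular \<Rightarrow> triangular" is "\<lambda>A i j. - A i j" by simp
lift_definition times_triangular :: "triangular \<Rightarrow> triangular \<Rightarrow> triangular"
  is "\<lambda>A B i j. \<Sum>l\<in>{i..j}. A i l * B l j" by simp

lemmas entry_simps [simp] =
  zero_triangular.rep_eq one_triangular.rep_eq plus_triangular.rep_eq minus_triangular.rep_eq
  uminus_triangular.rep_eq

instance
proof
  fix A B C :: triangular
  show "A * B * C = A * (B * C)"
  proof (rule triangular_eqI)
    fix i j :: nat assume "i \<le> j"
    have "entry (A * B * C) i j = (\<Sum>l\<in>{i..j}. \<Sum>m\<in>{i..j}. entry A i m * entry B m l * entry C l j)"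
      unfolding times_triangular.rep_eq sum_distrib_right
      by (intro sum.cong refl sum.mono_neutral_left) auto
    also have "\<dots> = (\<Sum>m\<in>{i..j}. \<Sum>l\<in>{i..j}. entry A i m * entry B m l * entry C l j)"
      by (rule sum.swap)
    also have "\<dots> = entry (A * (B * C)) i j"
      unfolding times_triangular.rep_eq sum_distrib_left mult.assoc
      by (intro sum.cong refl sum.mono_neutral_right) auto
    finally show "entry (A * B * C) i j = entry (A * (B * C)) i j" .
  qed
  have "(\<Sum>l = i..j. (if i = l then 1 else 0) * entry A l j) = entry A i j" if "i \<le> j" for i j
    using that by (simp add: if_distrib[of "\<lambda>x. x * _"] cong: if_cong)
  then show "1 * A = A" by (intro triangular_eqI) (simp add: times_triangular.rep_eq)
  have "(\<Sum>l = i..j. entry A i l * (if l = j then 1 else 0)) = entry A i j" if "i \<le> j" for i j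
    using that by (simp add: if_distrib[of "\<lambda>x. _ * x"] cong: if_cong)
  then show "A * 1 = A" by (intro triangular_eqI) (simp add: times_triangular.rep_eq)
  show "(A + B) * C = A * C + B * C" "A * (B + C) = A * B + A * C"
    by (auto intro!: triangular_eqI simp: times_triangular.rep_eq algebra_simps sum.distrib)
  have "entry (0 :: triangular) 0 0 \<noteq> entry 1 0 0" by simp
  then show "(0 :: triangular) \<noteq> 1" by metis
qed (auto intro!: triangular_eqI)

end

section \<open>Filtration by superdiagonals\<close>

definition level :: "nat \<Rightarrow> triangular set" where
  "level d = {A. \<forall>i j. j < i + d \<longrightarrow> entry A i j = 0}"

lemma level_0 [simp]: "A \<in> level 0"
  by (simp add: level_def)

lemma level_zero [simp]: "0 \<in> level d"
  by (simp add: level_def)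

lemma level_add: "A \<in> level d \<Longrightarrow> B \<in> level d \<Longrightarrow> A + B \<in> level d"
  by (simp add: level_def)

lemma level_uminus: "A \<in> level d \<Longrightarrow> - A \<in> level d"
  by (simp add: level_def)

lemma level_mono: "A \<in> level d \<Longrightarrow> e \<le> d \<Longrightarrow> A \<in> level e"
  by (simp add: level_def)

lemma level_mult:
  assumes "A \<in> level d" "B \<in> level e"
  shows "A * B \<in> level (d + e)"
  unfolding level_def
proof (clarify)
  fix i j :: nat assume ij: "j < i + (d + e)"
  have "entry A i l * entry B l j = 0" for l
    using assms ij unfolding level_def
    by (cases "l < i + d") auto
  then show "entry (A * B) i j = 0"
    unfolding times_triangular.rep_eq by (intro sum.neutral) blast
qed

lemma level_mult_left: "B \<in> level e \<Longrightarrow> A * B \<in> level e"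
  using level_mult[of A 0 B e] by simp

lemma level_mult_right: "A \<in> level d \<Longrightarrow> A * B \<in> level d"
  using level_mult[of A d B 0] by simp

lemma level_power: "A \<in> level 1 \<Longrightarrow> A ^ l \<in> level l"
  by (induction l) (use level_mult[of A 1] in auto)

lemma level_sum: "(\<And>x. x \<in> S \<Longrightarrow> f x \<in> level d) \<Longrightarrow> sum f S \<in> level d"
  by (induction S rule: infinite_finite_induct) (auto intro: level_add)

text \<open>Congruence modulo the two-sided ideal \<open>level d\<close>;
  \<open>level_eq 1 A 1\<close> says that \<open>A\<close> is unitriangular.\<close>

definition level_eq :: "nat \<Rightarrow> triangular \<Rightarrow> triangular \<Rightarrow> bool" where
  "level_eq d A B \<longleftrightarrow> A - B \<in> level d"

lemma level_eq_refl [simp]: "level_eq d A A"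
  by (simp add: level_eq_def)

lemma level_eq_sym: "level_eq d A B \<Longrightarrow> level_eq d B A"
  using level_uminus[of "A - B" d] by (simp add: level_eq_def)

lemma level_eq_trans [trans]: "level_eq d A B \<Longrightarrow> level_eq d B C \<Longrightarrow> level_eq d A C"
  using level_add[of "A - B" d "B - C"] by (simp add: level_eq_def)

lemma level_eq_mono: "level_eq d A B \<Longrightarrow> e \<le> d \<Longrightarrow> level_eq e A B"
  by (auto simp: level_eq_def intro: level_mono)

lemma level_eq_add: "level_eq d A A' \<Longrightarrow> level_eq d B B' \<Longrightarrow> level_eq d (A + B) (A' + B')"
  using level_add[of "A - A'" d "B - B'"] by (simp add: level_eq_def algebra_simps)

lemma level_eq_uminus: "level_eq d A B \<Longrightarrow> level_eq d (- A) (- B)"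
  using level_uminus[of "A - B" d] by (simp add: level_eq_def algebra_simps)

lemma level_eq_diff: "level_eq d A A' \<Longrightarrow> level_eq d B B' \<Longrightarrow> level_eq d (A - B) (A' - B')"
  using level_eq_add[of d A A' "- B" "- B'"] level_eq_uminus by simp

lemma level_eq_mult:
  assumes "level_eq d A A'" "level_eq d B B'"
  shows "level_eq d (A * B) (A' * B')"
proof -
  have "A * B - A' * B' = (A - A') * B + A' * (B - B')" by (simp add: algebra_simps)
  then show ?thesis
    using assms level_mult_right[of "A - A'" d B] level_mult_left[of "B - B'" d A']
    by (simp add: level_eq_def level_add)
qed

text \<open>The difference contains the factor \<open>A - 1\<close>, which raises the level by
  one.\<close>

lemma level_eq_unipotent_mult:
  assumes "level_eq 1 A 1" "D \<in> level d"
  shows "level_eq (Suc d) (A * D) D" "level_eq (Suc d) (D * A) D"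
proof -
  have "A * D - D = (A - 1) * D" "D * A - D = D * (A - 1)" by (simp_all add: algebra_simps)
  then show "level_eq (Suc d) (A * D) D" "level_eq (Suc d) (D * A) D"
    using level_mult[of "A - 1" 1 D d] level_mult[of D d "A - 1" 1] assms
    by (simp_all add: level_eq_def)
qed

text \<open>The geometric series for the inverse of a unitriangular \<open>T = 1 - (1 - T)\<close>,
  cut off where the powers of \<open>1 - T\<close> vanish modulo \<open>level K\<close>.\<close>

definition inverse_upto :: "nat \<Rightarrow> triangular \<Rightarrow> triangular" where
  "inverse_upto K T = (\<Sum>l<K. (1 - T) ^ l)"

lemma inverse_upto:
  assumes "level_eq 1 T 1"
  shows "level_eq K (T * inverse_upto K T) 1" "level_eq K (inverse_upto K T * T) 1"
    "level_eq 1 (inverse_upto K T) 1 \<or> K = 0"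
proof -
  let ?N = "1 - T"
  have "1 - T \<in> level 1" using assms level_eq_sym by (auto simp: level_eq_def)
  then have NK: "?N ^ K \<in> level K" by (rule level_power)
  have "(1 - N) * (\<Sum>l<K. N ^ l) = 1 - N ^ K" for N :: triangular
  proof (induction K)
    case (Suc K)
    have "(1 - N) * (\<Sum>l<Suc K. N ^ l) = (1 - N) * (\<Sum>l<K. N ^ l) + (N ^ K - N * N ^ K)"
      by (simp add: algebra_simps)
    then show ?case using Suc by simp
  qed simp
  moreover have "(\<Sum>l<K. N ^ l) * (1 - N) = 1 - N ^ K" for N :: triangular
  proof (induction K)
    case (Suc K)
    have "(\<Sum>l<Suc K. N ^ l) * (1 - N) = (\<Sum>l<K. N ^ l) * (1 - N) + (N ^ K - N ^ K * N)"
      by (simp add: algebra_simps)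
    then show ?case using Suc by (simp add: power_commutes)
  qed simp
  ultimately have "T * (\<Sum>l<K. ?N ^ l) = 1 - ?N ^ K" "(\<Sum>l<K. ?N ^ l) * T = 1 - ?N ^ K"
    by (metis diff_diff_eq2 add_diff_cancel_left')+
  then show "level_eq K (T * inverse_upto K T) 1" "level_eq K (inverse_upto K T * T) 1"
    using level_uminus[OF NK] by (simp_all add: level_eq_def inverse_upto_def)
  show "level_eq 1 (inverse_upto K T) 1 \<or> K = 0"
  proof (cases K)
    case (Suc k)
    have "(\<Sum>l<k. ?N ^ Suc l) \<in> level 1"
      using \<open>1 - T \<in> level 1\<close> by (intro level_sum) (auto intro: level_mult_right)
    then show ?thesis
      unfolding Suc inverse_upto_def sum.lessThan_Suc_shift by (simp add: level_eq_def)
  qed simp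
qed

lemma inverse_upto_unique:
  assumes "level_eq d (S * A) 1" "level_eq d (A * S') 1"
  shows "level_eq d S S'"
proof -
  have "level_eq d (S * (A * S')) (S * 1)" using assms(2) by (intro level_eq_mult) auto
  moreover have "level_eq d (S * A * S') (1 * S')" using assms(1) by (intro level_eq_mult) auto
  ultimately show ?thesis
    using level_eq_trans[OF level_eq_sym, of d "S * A * S'" S S'] by (simp add: mult.assoc)
qed

lemma of_int_triangular_entry: "entry (of_int m * A) i j = of_int m * entry A i j"
proof (induction m rule: int_induct[of _ 0])
  case (step1 m)
  then show ?case by (simp add: distrib_right)
next
  case (step2 m)
  then show ?case by (simp add: left_diff_distrib)
qed simp

text \<open>Rational entries allow the division by an exponent sum in
  \<open>solve_equation\<close>.\<close>

lemma level_divide: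
  assumes "m \<noteq> 0" "A \<in> level d"
  shows "\<exists>D \<in> level d. of_int m * D = A"
proof
  let ?D = "Triangular (\<lambda>i j. entry A i j / of_int m)"
  have D: "entry ?D i j = entry A i j / of_int m" for i j by (subst Triangular_inverse) auto
  show "of_int m * ?D = A"
    by (intro triangular_eqI) (use assms(1) in \<open>simp add: of_int_triangular_entry D\<close>)
  show "?D \<in> level d" using assms(2) by (simp add: level_def D)
qed

section \<open>Solving an equation in one unknown\<close>

definition eval_word :: "('a letter \<Rightarrow> triangular) \<Rightarrow> 'a letter list \<Rightarrow> triangular" where
  "eval_word f u = prod_list (map f u)"

lemma eval_word_simps [simp]:
  "eval_word f [] = 1" "eval_word f (a # u) = f a * eval_word f u"
  "eval_word f (u @ v) = eval_word f u * eval_word f v"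
  by (auto simp: eval_word_def)

lemma eval_word_cong: "(\<And>a. a \<in> set u \<Longrightarrow> f a = g a) \<Longrightarrow> eval_word f u = eval_word g u"
  by (induction u) auto

lemma eval_word_level_1: "(\<And>a. level_eq 1 (f a) 1) \<Longrightarrow> level_eq 1 (eval_word f u) 1"
  by (induction u) (use level_eq_mult[of 1 _ 1 _ 1] in auto)

text \<open>Inverse letters carry values of their own, which have to be inverses only modulo
  \<open>level K\<close>, as those from \<open>inverse_upto\<close> are.\<close>

lemma eval_word_eqv:
  assumes "eqv R u v" "\<And>a. level_eq K (f a * f (inv_letter a)) 1"
    "\<And>r. r \<in> R \<Longrightarrow> level_eq K (eval_word f r) 1"
  shows "level_eq K (eval_word f u) (eval_word f v)"
  using assms(1)
proof (induction rule: eqv.induct)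
  case (eqv_cancel u a v)
  have "level_eq K (eval_word f u * ((f a * f (inv_letter a)) * eval_word f v))
      (eval_word f u * (1 * eval_word f v))"
    using assms(2) by (intro level_eq_mult level_eq_refl)
  then show ?case by (simp add: mult.assoc)
next
  case (eqv_rel r u v)
  have "level_eq K (eval_word f u * (eval_word f r * eval_word f v))
      (eval_word f u * (1 * eval_word f v))"
    using assms(3)[OF eqv_rel] by (intro level_eq_mult level_eq_refl)
  then show ?case by simp
qed (auto intro: level_eq_sym level_eq_trans)

definition assign :: "nat \<Rightarrow> 'a \<Rightarrow> ('a letter \<Rightarrow> triangular) \<Rightarrow> triangular \<Rightarrow> 'a letter \<Rightarrow> triangular" where
  "assign K t f T a = (if fst a = t then if snd a then T else inverse_upto K T else f a)"

lemma assign_level_1: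
  assumes "\<And>a. level_eq 1 (f a) 1" "level_eq 1 T 1" "K > 0"
  shows "level_eq 1 (assign K t f T a) 1"
  using assms inverse_upto(3)[OF assms(2), of K] by (auto simp: assign_def)

lemma assign_inverse:
  assumes "\<And>a. level_eq K (f a * f (inv_letter a)) 1" "level_eq 1 T 1"
  shows "level_eq K (assign K t f T a * assign K t f T (inv_letter a)) 1"
  using assms inverse_upto[OF assms(2), of K] by (auto simp: assign_def inv_letter_def)

text \<open>To first order, \<open>w(T + D)\<close> is \<open>w(T) + m D\<close> for \<open>m\<close> the exponent sum of the unknown.\<close>

lemma eval_word_perturb:
  assumes f: "\<And>a. level_eq 1 (f a) 1" and T: "level_eq 1 T 1"
    and D: "D \<in> level d" "d > 0" "d < K"
  shows "level_eq (Suc d) (eval_word (assign K t f (T + D)) u)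
    (eval_word (assign K t f T) u + of_int (exponent_sum t u) * D)"
proof -
  have T': "level_eq 1 (T + D) 1"
    using T level_mono[OF D(1), of 1] D(2) level_add[of "T - 1" 1 D]
    by (simp add: level_eq_def algebra_simps)
  let ?S = "inverse_upto K T" and ?S' = "inverse_upto K (T + D)"
  have K: "level_eq (Suc d) A B" if "level_eq K A B" for A B
    using level_eq_mono[OF that] D(3) by simp
  \<comment> \<open>To first order the inverse of \<open>T + D\<close> is \<open>?S - D\<close>:
    products of \<open>D\<close> with unitriangular matrices reduce to \<open>D\<close>, and
    \<open>D * D\<close> lies in \<open>level (d + d)\<close>, which is invisible at this precision
    since \<open>d > 0\<close>.\<close>
  have S: "level_eq (Suc d) ?S' (?S - D)"
  proof (rule inverse_upto_unique)
    show "level_eq (Suc d) (?S' * (T + D)) 1" using K inverse_upto(2)[OF T'] by blast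
    have "level_eq 1 ?S 1" using inverse_upto(3)[OF T, of K] D by auto
    then have "level_eq (Suc d) (D * ?S) D" using D(1) by (rule level_eq_unipotent_mult)
    moreover have "level_eq (Suc d) (T * D) D" using T D(1) by (rule level_eq_unipotent_mult)
    moreover have "level_eq (Suc d) (T * ?S) 1" using K inverse_upto(1)[OF T] by blast
    moreover have "level_eq (Suc d) (D * D) 0"
      using level_mono[OF level_mult[OF D(1,1)], of "Suc d"] D(2) by (simp add: level_eq_def)
    ultimately have "level_eq (Suc d) (T * ?S - T * D + D * ?S - D * D) (1 - D + D - 0)"
      by (intro level_eq_add level_eq_diff)
    then show "level_eq (Suc d) ((T + D) * (?S - D)) 1" by (simp add: algebra_simps)
  qed
  show ?thesis
  proof (induction u)
    case Nil
    show ?case by simp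
  next
    case (Cons a u)
    define e :: int where "e = (if fst a = t then if snd a then 1 else -1 else 0)"
    define m where "m = exponent_sum t u"
    let ?g = "assign K t f T" and ?h = "assign K t f (T + D)"
    have a: "level_eq (Suc d) (?h a) (?g a + of_int e * D)"
      using S by (auto simp: assign_def e_def)
    have g1: "level_eq 1 (?g a) 1" "level_eq 1 (eval_word ?g u) 1"
      using assign_level_1[of f T K t, OF f T] eval_word_level_1[of ?g u] D by auto
    have mult: "of_int k * D \<in> level d" for k by (intro level_mult_left D)
    have "level_eq (Suc d) (?h a * eval_word ?h u)
      ((?g a + of_int e * D) * (eval_word ?g u + of_int m * D))"
      using a Cons.IH unfolding m_def by (rule level_eq_mult)
    also have "(?g a + of_int e * D) * (eval_word ?g u + of_int m * D) =
      ?g a * eval_word ?g u + (?g a * (of_int m * D)) + (of_int e * D) * eval_word ?g u +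
      (of_int e * D) * (of_int m * D)" by (simp only: algebra_simps)
    also have "level_eq (Suc d) \<dots> (?g a * eval_word ?g u + of_int m * D + of_int e * D + 0)"
    proof (intro level_eq_add level_eq_refl)
      show "level_eq (Suc d) (?g a * (of_int m * D)) (of_int m * D)"
        using g1(1) mult by (rule level_eq_unipotent_mult)
      show "level_eq (Suc d) (of_int e * D * eval_word ?g u) (of_int e * D)"
        using g1(2) mult by (rule level_eq_unipotent_mult)
      show "level_eq (Suc d) (of_int e * D * (of_int m * D)) 0"
        using level_mono[OF level_mult[OF mult mult], of "Suc d"] D(2) by (simp add: level_eq_def)
    qed
    finally show ?case by (simp add: e_def m_def distrib_right add_ac)
  qed
qed

text \<open>Successive approximation, one superdiagonal at a time from \<open>T = 1\<close>: the
  current error, divided by the exponent sum, is added to \<open>T\<close>, which by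
  \<open>eval_word_perturb\<close> pushes the error one level further.\<close>

lemma solve_equation:
  assumes f: "\<And>a. level_eq 1 (f a) 1" and w: "exponent_sum t w \<noteq> 0"
  shows "d < K \<Longrightarrow> \<exists>T. level_eq 1 T 1 \<and> level_eq (Suc d) (eval_word (assign K t f T) w) 1"
proof (induction d)
  case 0
  have "level_eq 1 (eval_word (assign K t f 1) w) 1"
    using 0 f by (intro eval_word_level_1 assign_level_1) auto
  then show ?case by (intro exI[of _ 1]) simp
next
  case (Suc d)
  then obtain T where T: "level_eq 1 T 1" "level_eq (Suc d) (eval_word (assign K t f T) w) 1"
    by auto
  define E where "E = 1 - eval_word (assign K t f T) w"
  have "E \<in> level (Suc d)" using level_eq_sym[OF T(2)] by (simp add: E_def level_eq_def)
  from level_divide[OF w this] obtain D where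
    D: "D \<in> level (Suc d)" "of_int (exponent_sum t w) * D = E" by blast
  have "level_eq (Suc (Suc d)) (eval_word (assign K t f (T + D)) w) 1"
    using eval_word_perturb[of f T D "Suc d" K t w, OF f T(1) D(1)] Suc.prems D(2) by (simp add: E_def)
  moreover have "level_eq 1 (T + D) 1"
    using T(1) level_mono[OF D(1), of 1] level_add[of "T - 1" 1 D]
    by (simp add: level_eq_def algebra_simps)
  ultimately show ?case by blast
qed

section \<open>Matrices that separate the elements of a free group\<close>

lift_definition superdiagonal :: "(nat \<Rightarrow> rat) \<Rightarrow> triangular"
  is "\<lambda>f i j. if j = Suc i then f i else 0" by simp

lemma superdiagonal_mult_entry:
  "entry (superdiagonal f * A) i j = f i * entry A (Suc i) j"
proof (cases "Suc i \<le> j")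
  case True
  have "entry (superdiagonal f * A) i j =
    (\<Sum>l\<in>{i..j}. if l = Suc i then f i * entry A l j else 0)"
    unfolding times_triangular.rep_eq superdiagonal.rep_eq by (intro sum.cong) auto
  also have "\<dots> = f i * entry A (Suc i) j" using True by simp
  finally show ?thesis .
next
  case False
  then show ?thesis
    unfolding times_triangular.rep_eq superdiagonal.rep_eq by (auto intro!: sum.neutral)
qed

lemma superdiagonal_level: "superdiagonal f \<in> level 1"
  by (simp add: level_def superdiagonal.rep_eq)

text \<open>The matrix of \<open>x\<close> has a unit above the diagonal in the rows that belong to \<open>x\<close>-syllables.
  Adjacent syllables belong to different generators, so its square is zero, and the corner entry of
  a product of syllables is the product of their exponents.\<close>

definition syllable_matrix :: "'a list \<Rightarrow> 'a \<Rightarrow> triangular" where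
  "syllable_matrix ys x = superdiagonal (\<lambda>i. if i < length ys \<and> ys ! i = x then 1 else 0)"

definition syllable_assign :: "'a list \<Rightarrow> 'a letter \<Rightarrow> triangular" where
  "syllable_assign ys a =
    (if snd a then 1 + syllable_matrix ys (fst a) else 1 - syllable_matrix ys (fst a))"

lemma syllable_matrix_square:
  assumes "successively (\<noteq>) ys"
  shows "syllable_matrix ys x * syllable_matrix ys x = 0"
proof (rule triangular_eqI)
  have "\<not> (Suc i < length ys \<and> ys ! i = x \<and> ys ! Suc i = x)" for i
    using assms by (auto simp: successively_conv_nth)
  then show "entry (syllable_matrix ys x * syllable_matrix ys x) i j = entry 0 i j" for i j
    by (auto simp: syllable_matrix_def superdiagonal_mult_entry superdiagonal.rep_eq)
qed

lemma syllable_assign_inverse: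
  "successively (\<noteq>) ys \<Longrightarrow> syllable_assign ys a * syllable_assign ys (inv_letter a) = 1"
  by (auto simp: syllable_assign_def inv_letter_def algebra_simps syllable_matrix_square)

lemma syllable_assign_level_1: "level_eq 1 (syllable_assign ys a) 1"
  using superdiagonal_level level_uminus[OF superdiagonal_level]
  by (auto simp: syllable_assign_def level_eq_def syllable_matrix_def)

text \<open>The nilpotent part N has square zero, so the power of 1 + N with exponent m is 1 + m
  N.\<close>

lemma eval_word_syllable:
  assumes "successively (\<noteq>) ys" "word_on {x} u"
  shows "eval_word (syllable_assign ys) u = 1 + of_int (exponent_sum x u) * syllable_matrix ys x"
  using assms(2)
proof (induction u)
  case (Cons a u)
  have "of_int m * syllable_matrix ys x = syllable_matrix ys x * of_int m" for m
    using mult_of_int_commute by metis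
  then have "syllable_matrix ys x * (of_int m * syllable_matrix ys x) = 0" for m
    using syllable_matrix_square[OF assms(1)] by (metis mult.assoc mult_zero_left)
  then show ?case using Cons by (auto simp: syllable_assign_def algebra_simps)
qed simp

text \<open>Downward induction on \<open>k\<close>. The last column of the suffix product vanishes
  above row \<open>k\<close>, so the preceding syllable moves the entry up by one row and scales it
  by the exponent sum, although its generator may own other rows above.\<close>

lemma corner_entry:
  assumes "successively (\<noteq>) (map fst gs)" "\<forall>(x, g) \<in> set gs. word_on {x} g" "k \<le> length gs"
  shows "entry (eval_word (syllable_assign (map fst gs)) (concat (map snd (drop k gs)))) k (length gs) =
      (\<Prod>(x, g)\<leftarrow>drop k gs. of_int (exponent_sum x g)) \<and>
    (\<forall>i<k. entry (eval_word (syllable_assign (map fst gs)) (concat (map snd (drop k gs)))) i (length gs) = 0)"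
  using assms(3)
proof (induction k rule: inc_induct)
  case base
  then show ?case by simp
next
  case (step k)
  let ?ys = "map fst gs"
  let ?P = "eval_word (syllable_assign ?ys) (concat (map snd (drop (Suc k) gs)))"
  obtain x g where g: "gs ! k = (x, g)" by (cases "gs ! k")
  have drop: "drop k gs = (x, g) # drop (Suc k) gs"
    using step.hyps g by (metis Cons_nth_drop_Suc)
  have wg: "word_on {x} g" using assms(2) g step.hyps nth_mem by fastforce
  have row: "entry (eval_word (syllable_assign ?ys) (concat (map snd (drop k gs)))) i (length gs) =
    entry ?P i (length gs) + of_int (exponent_sum x g) *
      ((if i < length gs \<and> ?ys ! i = x then 1 else 0) * entry ?P (Suc i) (length gs))" for i
    unfolding drop
    by (simp add: eval_word_syllable[OF assms(1) wg] distrib_right mult.assoc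
        of_int_triangular_entry syllable_matrix_def superdiagonal_mult_entry)
  show ?case using row step g by (auto simp: drop)
qed

text \<open>The syllables of a relation \<open>u\<close> without \<open>t\<close> dictate the
  matrices of the other generators, and \<open>solve_equation\<close> supplies one for
  \<open>t\<close>. Then \<open>u\<close> evaluates to 1 modulo \<open>level ?K\<close>, whereas its
  corner entry is a product of nonzero exponent sums, so there are no syllables.\<close>

theorem free_on_nonzero_exponent_sum:
  assumes w: "exponent_sum t w \<noteq> 0"
  shows "free_on (- {t}) {w}"
  unfolding free_on_def
proof (intro allI impI)
  fix u assume u: "word_on (- {t}) u" "eqv {w} u []"
  have "word_on (\<Union>x\<in>- {t}. {x}) u" using u(1) by simp
  from ex_alternating[OF this] obtain gs where gs: "alternating gs"
      "\<And>x g. (x, g) \<in> set gs \<Longrightarrow> x \<noteq> t \<and> word_on {x} g \<and> \<not> eqv {} g []"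
      "eqv {} u (concat (map snd gs))" by auto
  define ys where "ys = map fst gs"
  have ys: "successively (\<noteq>) ys"
    using gs(1) by (simp add: ys_def alternating_def successively_map)
  \<comment> \<open>The corner entry in row 0 and column \<open>length gs\<close> is visible only
    modulo a level above \<open>length gs\<close>, hence the \<open>Suc\<close>.\<close>
  let ?f = "syllable_assign ys" and ?K = "Suc (length gs)"
  obtain T where T: "level_eq 1 T 1" "level_eq ?K (eval_word (assign ?K t ?f T) w) 1"
    using solve_equation[of ?f, OF syllable_assign_level_1 w, of "length gs" ?K] by auto
  have "eqv {w} (concat (map snd gs)) []"
    using eqv_mono[OF gs(3), of "{w}"] u(2) eqv_sym eqv_trans by blast
  from eval_word_eqv[OF this, of ?K "assign ?K t ?f T"]
  have "level_eq ?K (eval_word (assign ?K t ?f T) (concat (map snd gs))) 1"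
    using assign_inverse[of ?K ?f T t] syllable_assign_inverse[OF ys] T by simp
  moreover have "eval_word (assign ?K t ?f T) (concat (map snd gs)) =
      eval_word ?f (concat (map snd gs))"
    using gs(2) by (intro eval_word_cong) (fastforce simp: assign_def word_on_def)
  ultimately have "entry (eval_word ?f (concat (map snd gs))) 0 (length gs) =
      entry 1 0 (length gs)"
    by (simp add: level_eq_def level_def)
  moreover have "entry (eval_word ?f (concat (map snd gs))) 0 (length gs) =
      (\<Prod>(x, g)\<leftarrow>gs. of_int (exponent_sum x g))"
    using corner_entry[of gs 0] ys gs(2) by (auto simp: ys_def)
  moreover have "(\<Prod>(x, g)\<leftarrow>gs. of_int (exponent_sum x g)) \<noteq> (0 :: rat)"
    using gs(2) one_generator_trivial by (fastforce simp: prod_list_zero_iff)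
  ultimately have "gs = []" by (auto split: if_splits)
  then show "eqv {} u []" using gs(3) by simp
qed

section \<open>The Freiheitssatz\<close>

text \<open>An iterated amalgam along a line; the generators common to neighbouring vertices form
  the edges. By \<open>separated\<close>, a generator that occurs on both sides of an edge belongs
  to that edge, so the chain can be cut anywhere.\<close>

locale amalgam_chain =
  fixes X :: "int \<Rightarrow> 'a set" and R :: "int \<Rightarrow> 'a letter list set"
  assumes relators: "r \<in> R s \<Longrightarrow> word_on (X s) r"
    and separated: "s \<le> c \<Longrightarrow> c < t \<Longrightarrow> X s \<inter> X t \<subseteq> X c \<inter> X (c + 1)"
    and free_right: "free_on (X c \<inter> X (c + 1)) (R c)"
    and free_left: "free_on (X c \<inter> X (c + 1)) (R (c + 1))"
begin

abbreviation gens :: "int \<Rightarrow> int \<Rightarrow> 'a set" where "gens a b \<equiv> \<Union>s\<in>{a..b}. X s"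
abbreviation rels :: "int \<Rightarrow> int \<Rightarrow> 'a letter list set" where "rels a b \<equiv> \<Union>s\<in>{a..b}. R s"

lemma gens_Int:
  assumes "a \<le> c" "c < b"
  shows "gens a c \<inter> gens (c + 1) b = X c \<inter> X (c + 1)"
proof
  show "gens a c \<inter> gens (c + 1) b \<subseteq> X c \<inter> X (c + 1)"
  proof
    fix x assume "x \<in> gens a c \<inter> gens (c + 1) b"
    then obtain s t where "x \<in> X s \<inter> X t" "s \<le> c" "c < t" by auto
    then show "x \<in> X c \<inter> X (c + 1)" using separated[of s c t] by blast
  qed
  show "X c \<inter> X (c + 1) \<subseteq> gens a c \<inter> gens (c + 1) b"
  proof -
    have "c \<in> {a..c}" "c + 1 \<in> {c + 1..b}" using assms by auto
    then show ?thesis by blast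
  qed
qed

text \<open>Freeness of the edge in both halves is a hypothesis because
  \<open>vertex_embeds\<close>, which yields it, relies on this cut; \<open>chain_split\<close>
  discharges it.\<close>

lemma split:
  assumes "a \<le> c" "c < b"
    and "free_on (X c \<inter> X (c + 1)) (rels a c)" "free_on (X c \<inter> X (c + 1)) (rels (c + 1) b)"
  shows "amalgam (\<lambda>l. if l then gens a c else gens (c + 1) b)
    (\<lambda>l. if l then rels a c else rels (c + 1) b)"
proof
  show "word_on (if l then gens a c else gens (c + 1) b) r"
    if "r \<in> (if l then rels a c else rels (c + 1) b)" for r l
  proof -
    from that obtain s where s: "r \<in> R s" "if l then s \<in> {a..c} else s \<in> {c+1..b}"
      by (cases l) auto
    show ?thesis by (rule word_on_mono[OF relators[OF s(1)]]) (use s(2) in \<open>cases l; auto\<close>)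
  qed
qed (use assms gens_Int[OF assms(1,2)] in auto)

lemma rels_split: "a \<le> c \<Longrightarrow> c < b \<Longrightarrow> rels a b = rels a c \<union> rels (c + 1) b"
proof -
  assume "a \<le> c" "c < b"
  then have "{a..b} = {a..c} \<union> {c + 1..b}" by auto
  then show ?thesis by (simp add: UN_Un)
qed

text \<open>Induction on the right end: the induction hypothesis for the last vertex makes the edge
  free in the segment so far, which permits the next vertex to be amalgamated.\<close>

lemma vertex_embeds:
  assumes "a \<le> b" "s \<in> {a..b}" "word_on (X s) u" "eqv (rels a b) u []"
  shows "eqv (R s) u []"
  using assms
proof (induction b arbitrary: s u rule: int_ge_induct)
  case base
  then show ?case by simp
next
  case (step b)
  have fr: "free_on (X b \<inter> X (b + 1)) (rels a b)"
    unfolding free_on_def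
  proof (intro allI impI)
    fix u assume u: "word_on (X b \<inter> X (b + 1)) u" "eqv (rels a b) u []"
    then have "eqv (R b) u []" using step word_on_mono[OF u(1)] by auto
    then show "eqv {} u []" using free_right u by (auto simp: free_on_def)
  qed
  have "amalgam (\<lambda>l. if l then gens a b else gens (b + 1) (b + 1))
    (\<lambda>l. if l then rels a b else rels (b + 1) (b + 1))"
    using step fr free_left by (intro split) auto
  from amalgam.factor_embeds[OF this, of "s \<le> b" u]
  have e: "word_on (if s \<le> b then gens a b else X (b + 1)) u \<Longrightarrow>
      eqv (if s \<le> b then rels a b else R (b + 1)) u []"
    using step.prems(3) rels_split[of a b "b + 1"] step.hyps by (auto split: if_splits)
  show ?case
  proof (cases "s \<le> b")
    case True
    have "word_on (gens a b) u" using step True by (intro word_on_mono[OF step.prems(2)]) auto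
    then show ?thesis using e True step by auto
  next
    case False
    then have "s = b + 1" using step.prems by simp
    then show ?thesis using e step by simp
  qed
qed

lemma free_on_rels:
  assumes "free_on Y (R s)" "Y \<subseteq> X s" "s \<in> {a..b}"
  shows "free_on Y (rels a b)"
  unfolding free_on_def
proof (intro allI impI)
  fix u assume u: "word_on Y u" "eqv (rels a b) u []"
  then have "eqv (R s) u []" using assms word_on_mono[OF u(1)] by (intro vertex_embeds) auto
  then show "eqv {} u []" using assms u by (auto simp: free_on_def)
qed

lemma chain_split:
  assumes "a \<le> c" "c < b"
  shows "amalgam (\<lambda>l. if l then gens a c else gens (c + 1) b)
    (\<lambda>l. if l then rels a c else rels (c + 1) b)"
  using assms free_on_rels[OF free_right[of c], of a c] free_on_rels[OF free_left[of c], of "c + 1" b]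
  by (intro split) auto

end

lemma eqv_relators:
  assumes "eqv R u v" "\<And>r. r \<in> R \<Longrightarrow> eqv S r []"
  shows "eqv S u v"
  using assms(1)
proof (induction rule: eqv.induct)
  case (eqv_rel r u v)
  then show ?case using eqv_context[OF assms(2), of r u v] by simp
next
  case (eqv_cancel u a v)
  show ?case by (rule eqv.eqv_cancel)
qed (rule eqv.eqv_refl | (rule eqv.eqv_sym, assumption) | (rule eqv.eqv_trans, assumption, assumption))+

lemma eqv_rotate: "eqv R (u @ v) [] \<Longrightarrow> eqv R (v @ u) []"
proof -
  assume "eqv R (u @ v) []"
  then have "eqv R v (word_inv u)" by (simp add: eqv_cancel_left)
  then have "eqv R (v @ u) (word_inv u @ u)" by (intro eqv_append eqv_refl)
  then show ?thesis using eqv_word_inv_left eqv_trans by blast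
qed

section \<open>Reduced and cyclically reduced words\<close>

lemma eqv_imp_reduced_form_eq: "eqv {} u v \<Longrightarrow> foldr push u [] = foldr push v []"
proof (induction rule: eqv.induct)
  case (eqv_cancel u a v)
  then show ?case
    using push_inv[of "foldr push v []" "inv_letter a"] reduced_foldr_push[of "[]" v] by simp
qed simp_all

lemma reduced_trivial: "reduced u \<Longrightarrow> eqv {} u [] \<Longrightarrow> u = []"
  using eqv_imp_reduced_form_eq[of u "[]"] foldr_push_Nil[of u] by simp

lemma involves_iff: "involves w x \<longleftrightarrow> x \<in> fst ` set w"
proof -
  have "(x, b) \<in> set w \<Longrightarrow> involves w x" for b by (cases b) (auto simp: involves_def)
  then show ?thesis by (force simp: involves_def)
qed

lemma reduced_append:
  "reduced (u @ v) \<longleftrightarrow> reduced u \<and> reduced v \<and>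
    (u \<noteq> [] \<longrightarrow> v \<noteq> [] \<longrightarrow> hd v \<noteq> inv_letter (last u))"
  by (auto simp: reduced_def successively_append_iff)

lemma cyclically_reduced_rotate:
  assumes "cyclically_reduced (u @ v)"
  shows "cyclically_reduced (v @ u)"
proof (cases "u = [] \<or> v = []")
  case False
  then show ?thesis using assms by (auto simp: cyclically_reduced_def reduced_append)
qed (use assms in auto)

lemma reduced_rename:
  assumes "inj f" "reduced u"
  shows "reduced (rename f u)"
  using assms(2)
proof (induction u)
  case (Cons a u)
  then show ?case using injD[OF assms(1)]
    by (cases u) (auto simp: reduced_Cons inv_letter_def prod_eq_iff)
qed simp

lemma cyclically_reduced_rename:
  assumes "inj f" "cyclically_reduced u"
  shows "cyclically_reduced (rename f u)"
  using assms reduced_rename[OF assms(1), of u] injD[OF assms(1)]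
  by (cases "u = []")
    (auto simp: cyclically_reduced_def rename_def hd_map last_map inv_letter_def prod_eq_iff)

lemma involves_rename: "inj f \<Longrightarrow> involves (rename f w) (f x) \<longleftrightarrow> involves w x"
proof -
  have "fst ` set (rename f w) = f ` fst ` set w" for w :: "'a letter list"
    by (simp add: rename_def image_image)
  moreover assume "inj f"
  ultimately show ?thesis by (simp add: involves_iff inj_image_mem_iff)
qed

text \<open>Rewriting of \<open>u\<close> in the generators \<open>(x, j) = t\<^sup>j x t\<^sup>-\<^sup>j\<close>, starting at level \<open>j\<close>.\<close>

fun rewrite :: "'a \<Rightarrow> int \<Rightarrow> 'a letter list \<Rightarrow> ('a \<times> int) letter list" where
  "rewrite t j [] = []"
| "rewrite t j (a # u) =
    (if fst a = t then rewrite t (if snd a then j + 1 else j - 1) u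
     else ((fst a, j), snd a) # rewrite t j u)"

lemma rewrite_append:
  "rewrite t j (u @ v) = rewrite t j u @ rewrite t (j + exponent_sum t u) v"
  by (induction u arbitrary: j) (auto simp: algebra_simps)

lemma rewrite_shift: "rewrite t (j + s) u = rename (\<lambda>(x, i). (x, i + s)) (rewrite t j u)"
proof (induction u arbitrary: j)
  case (Cons a u)
  from Cons[of "j + 1"] Cons[of "j - 1"] Cons[of j] show ?case by (simp add: algebra_simps)
qed simp

lemma rewrite_rename: "word_on (- {t}) u \<Longrightarrow> rewrite t j u = rename (\<lambda>x. (x, j)) u"
  by (induction u) auto

lemma length_rewrite: "length (rewrite t j u) \<le> length u"
  by (induction u arbitrary: j) (auto simp: le_SucI)

lemma length_rewrite_less: "involves u t \<Longrightarrow> length (rewrite t j u) < length u"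
proof (induction u arbitrary: j)
  case (Cons a u)
  show ?case
  proof (cases "fst a = t")
    case True
    then show ?thesis using length_rewrite[of t _ u] by (simp add: less_Suc_eq_le)
  next
    case False
    then show ?thesis using Cons by (auto simp: involves_def)
  qed
qed (simp add: involves_def)

text \<open>Exponent sum zero brings the level back after \<open>w\<close>, so deleting
  \<open>w\<close> deletes one translate of its rewriting and leaves the letters behind it
  unchanged.\<close>

lemma eqv_rewrite:
  assumes "exponent_sum t w = 0" "eqv {w} u v"
  shows "eqv (range (\<lambda>s. rewrite t s w)) (rewrite t j u) (rewrite t j v)"
proof -
  have "\<forall>j. eqv (range (\<lambda>s. rewrite t s w)) (rewrite t j u) (rewrite t j v)"
    using assms(2)
  proof (induction rule: eqv.induct)
    case (eqv_cancel u a v)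
    show ?case
      using eqv.eqv_cancel[of _ "rewrite t _ u" "((fst a, _), snd a)"]
      by (auto simp: rewrite_append inv_letter_def)
  next
    case (eqv_rel r u v)
    then show ?case using assms(1)
      by (auto simp: rewrite_append intro!: eqv.eqv_rel)
  next
    case (eqv_sym u v)
    then show ?case using eqv.eqv_sym by blast
  next
    case (eqv_trans u v w)
    then show ?case using eqv.eqv_trans by blast
  qed simp
  then show ?thesis ..
qed

text \<open>In a reduced word a run of letters \<open>t\<close> keeps its direction, so the level
  moves monotonically until the first letter is written.\<close>

lemma head_level:
  assumes "reduced ((t, e) # u)" "rewrite t j u \<noteq> []"
  shows "if e then j \<le> snd (fst (hd (rewrite t j u))) else snd (fst (hd (rewrite t j u))) \<le> j"
  using assms
proof (induction u arbitrary: j)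
  case (Cons a u)
  show ?case
  proof (cases "fst a = t")
    case True
    then have "a = (t, e)" using Cons.prems(1)
      by (cases a) (auto simp: reduced_Cons inv_letter_def)
    then show ?thesis using Cons.IH[of "j + 1"] Cons.IH[of "j - 1"] Cons.prems
      by (cases e) (auto simp: reduced_Cons)
  qed auto
qed simp

lemma head_level_neq:
  assumes "reduced (a # u)" "fst a = t" "rewrite t j (a # u) \<noteq> []"
  shows "snd (fst (hd (rewrite t j (a # u)))) \<noteq> j"
  using head_level[of t "snd a" u "if snd a then j + 1 else j - 1"] assms
  by (cases a) (auto split: if_splits)

text \<open>Letters that become adjacent were separated by a nontrivial power of \<open>t\<close>
  and get different levels by \<open>head_level_neq\<close>; letters that were adjacent before do
  not cancel because \<open>u\<close> is reduced.\<close>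

lemma reduced_rewrite: "reduced u \<Longrightarrow> reduced (rewrite t j u)"
proof (induction u arbitrary: j)
  case (Cons a u)
  then have red: "reduced (rewrite t j u)" for j by (simp add: reduced_Cons)
  show ?case
  proof (cases "fst a = t")
    case False
    have "hd (rewrite t j u) \<noteq> inv_letter ((fst a, j), snd a)" if ne: "rewrite t j u \<noteq> []"
    proof -
      obtain b v where u: "u = b # v" using ne by (cases u) auto
      have b: "b \<noteq> inv_letter a" "reduced (b # v)" using Cons.prems by (auto simp: u reduced_Cons)
      show ?thesis
      proof (cases "fst b = t")
        case True
        then show ?thesis using head_level_neq[OF b(2) True, of j] ne
          by (auto simp: u inv_letter_def)
      next
        case False
        then show ?thesis using b(1) by (auto simp: u inv_letter_def prod_eq_iff)
      qed
    qed
    then show ?thesis using red False by (auto simp: reduced_Cons)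
  qed (use red in auto)
qed simp

text \<open>For exponent sum zero, this rotation makes the rewriting cyclically reduced: its last
  letter has the starting level, its first letter another one. The cut is after the last letter
  other than \<open>t\<close> or before the first \<open>t\<close>.\<close>

lemma ex_rotation:
  assumes "involves w t" "\<not> word_on {t} w"
  shows "\<exists>u v. w = u @ v \<and> (\<exists>a p y. v @ u = a # p @ [y] \<and> fst a = t \<and> fst y \<noteq> t)"
proof -
  have split: "\<exists>a p y. v = a # p @ [y] \<and> fst a = t \<and> fst y \<noteq> t"
    if v: "v \<noteq> []" "fst (hd v) = t" "fst (last v) \<noteq> t" for v :: "('a \<times> bool) list"
  proof -
    obtain a q where q: "v = a # q" using v by (cases v) auto
    then have "q \<noteq> []" using v by auto
    then have "v = a # butlast q @ [last q]" by (simp add: q)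
    then show ?thesis using v \<open>q \<noteq> []\<close> 
      by (intro exI[of _ a] exI[of _ "butlast q"] exI[of _ "last q"]) (auto simp: q)
  qed
  show ?thesis
  proof (cases "fst (last w) = t")
    case True
    have "\<exists>y \<in> set w. fst y \<noteq> t" using assms(2) by (auto simp: word_on_def)
    then obtain u y v where w: "w = u @ y # v" "fst y \<noteq> t" "\<forall>z \<in> set v. fst z = t"
      using split_list_last_prop[of w "\<lambda>y. fst y \<noteq> t"] by auto
    have "v \<noteq> []" using w True by auto
    then show ?thesis using w split[of "v @ u @ [y]"]
      by (intro exI[of _ "u @ [y]"] exI[of _ v]) auto
  next
    case False
    have "\<exists>a \<in> set w. fst a = t" using assms(1) by (auto simp: involves_iff)
    then obtain u a v where w: "w = u @ a # v" "fst a = t" "\<forall>z \<in> set u. fst z \<noteq> t"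
      using split_list_first_prop[of w "\<lambda>y. fst y = t"] by auto
    have "fst (last (a # v @ u)) \<noteq> t" using w False by (cases "u = []") auto
    then show ?thesis using w split[of "a # v @ u"]
      by (intro exI[of _ u] exI[of _ "a # v"]) auto
  qed
qed

lemma free_on_rename_imp:
  assumes "inj f" "free_on (- {f x}) {rename f w}"
  shows "free_on (- {x}) {w}"
  unfolding free_on_def
proof (intro allI impI)
  fix u assume u: "word_on (- {x}) u" "eqv {w} u []"
  have "word_on (- {f x}) (rename f u)" unfolding word_on_rename
    by (rule word_on_mono[OF u(1)]) (use assms(1) in \<open>auto dest: injD\<close>)
  moreover have "eqv {rename f w} (rename f u) []" using eqv_rename[OF u(2), of f] by simp
  ultimately have "eqv (rename f ` {}) (rename f u) (rename f [])"
    using assms(2) by (simp add: free_on_def)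
  then show "eqv {} u []"
    using eqv_rename_iff[OF assms(1), of "{}" u "[]"] by (simp add: word_on_def)
qed

text \<open>The case of exponent sum zero: the conjugates \<open>(x, j) = t\<^sup>j x t\<^sup>-\<^sup>j\<close> generate a chain of amalgamated
  products of one-relator groups with shorter relators.\<close>

lemma free_on_zero_exponent_sum:
  assumes red: "cyclically_reduced w" and w: "w = a # p @ [y]" "fst a = t" "fst y \<noteq> t"
    and e: "exponent_sum t w = 0"
    and IH: "\<And>s z. cyclically_reduced (rewrite t s w) \<Longrightarrow> involves (rewrite t s w) z \<Longrightarrow>
      free_on (- {z}) {rewrite t s w}"
  shows "free_on (- {t}) {w}"
proof -
  let ?W = "\<lambda>s. rewrite t s w"
  define x where "x = fst y"
  have e': "exponent_sum t (a # p) = 0" using e w by auto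
  have W: "?W s = rewrite t s (a # p) @ [((x, s), snd y)]" for s
    using rewrite_append[of t s "a # p" "[y]"] w(3) e' by (simp only: w(1)) (simp add: x_def)
  have hd: "snd (fst (hd (?W s))) \<noteq> s" for s
    using head_level_neq[of a "p @ [y]" t s] red w W[of s] by (auto simp: cyclically_reduced_def)
  have cyc: "cyclically_reduced (?W s)" for s
    using reduced_rewrite[of w t s] red hd[of s] W[of s]
    by (auto simp: cyclically_reduced_def inv_letter_def)
  have inv: "involves (?W s) (z, j) \<longleftrightarrow> involves (?W 0) (z, j - s)" for s z j
  proof -
    have "inj (\<lambda>(x :: 'a, i). (x, i + s))" by (auto simp: inj_def)
    from involves_rename[OF this, of "?W 0" "(z, j - s)"] show ?thesis
      using rewrite_shift[of t 0 s w] by simp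
  qed
  define J where "J = {j. involves (?W 0) (x, j)}"
  have "J = {j. (x, j) \<in> fst ` set (?W 0)}" by (auto simp: J_def involves_iff)
  also have "\<dots> \<subseteq> snd ` fst ` set (?W 0)" by force
  finally have J: "finite J" by (rule finite_subset) auto
  have "0 \<in> J" using W[of 0] by (auto simp: J_def involves_iff)
  define m M where "m = Min J" and "M = Max J"
  have mM: "m \<in> J" "M \<in> J" "m \<le> 0" "0 \<le> M" "\<And>j. j \<in> J \<Longrightarrow> m \<le> j \<and> j \<le> M"
    unfolding m_def M_def using J \<open>0 \<in> J\<close> Min_in[of J] Max_in[of J] Min_le[of J] Max_ge[of J]
    by blast+
  \<comment> \<open>Vertex \<open>s\<close> restricts only the conjugates of \<open>x\<close>, to
    the span that they have in \<open>?W s\<close>. The edge between \<open>c\<close> and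
    \<open>c + 1\<close> then lacks \<open>(x, c + m)\<close> and \<open>(x, c + 1 + M)\<close>,
    which occur in the relators of its two ends, so both freeness conditions come from
    \<open>IH\<close>.\<close>
  define X where "X s = {(z, j). z \<noteq> x \<or> (s + m \<le> j \<and> j \<le> s + M)}" for s
  have edge: "free_on Y {?W s}" if "z \<notin> Y" "involves (?W s) z" for s z Y
    using free_on_mono[OF IH[OF cyc that(2)], of Y] that(1) by auto
  interpret amalgam_chain X "\<lambda>s. {?W s}"
  proof
    show "word_on (X s) r" if "r \<in> {?W s}" for r s
    proof -
      have "z \<in> X s" if "involves (?W s) z" for z
        using that inv[of s "fst z" "snd z"] mM(5)[of "snd z - s"]
        by (cases z) (auto simp: X_def J_def)
      then show ?thesis using that by (auto simp: word_on_def involves_iff)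
    qed
    show "X s \<inter> X u \<subseteq> X c \<inter> X (c + 1)" if "s \<le> c" "c < u" for s c u
      using that by (auto simp: X_def)
    show "free_on (X c \<inter> X (c + 1)) {?W c}" for c
      by (rule edge[of "(x, c + m)"]) (use mM inv[of c x] in \<open>auto simp: X_def J_def\<close>)
    show "free_on (X c \<inter> X (c + 1)) {?W (c + 1)}" for c
      by (rule edge[of "(x, c + 1 + M)"]) (use mM inv[of "c + 1" x] in \<open>auto simp: X_def J_def\<close>)
  qed
  show ?thesis unfolding free_on_def
  proof (intro allI impI)
    fix u assume u: "word_on (- {t}) u" "eqv {w} u []"
    let ?u = "rename (\<lambda>z. (z, 0 :: int)) u"
    have "eqv (range ?W) ?u []"
      using eqv_rewrite[OF e u(2), of 0] rewrite_rename[OF u(1), of 0] by simp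
    then obtain S where S: "S \<subseteq> range ?W" "finite S" "eqv S ?u []"
      using eqv_finitely_many_relators by blast
    obtain I where I: "finite I" "S = ?W ` I" using finite_subset_image[OF S(2,1)] by auto
    \<comment> \<open>Vertex \<open>- m\<close> is included because its levels of \<open>x\<close>
      begin at 0, so that it contains every generator of level 0.\<close>
    define b c where "b = Min (insert (- m) I)" and "c = Max (insert (- m) I)"
    have bc: "- m \<in> {b..c}" "I \<subseteq> {b..c}" using I(1) by (auto simp: b_def c_def)
    have "eqv (rels b c) ?u []" using S(3) bc(2) I(2) by (auto intro: eqv_mono)
    moreover have zero: "word_on (UNIV \<times> {0}) ?u" by (auto simp: word_on_def rename_def)
    then have "word_on (X (- m)) ?u" by (rule word_on_mono) (use mM in \<open>auto simp: X_def\<close>)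
    ultimately have triv: "eqv {?W (- m)} ?u []" using bc by (intro vertex_embeds) auto
    \<comment> \<open>A generator of nonzero level in the relator makes level 0 a Magnus subset of
      vertex \<open>- m\<close>. For \<open>m = 0\<close> the first letter provides it, otherwise
      the last letter \<open>(x, - m)\<close>.\<close>
    have "\<exists>z. involves (?W (- m)) z \<and> snd z \<noteq> 0"
    proof (cases "m = 0")
      case True
      have "?W 0 \<noteq> []" using W[of 0] by simp
      then have "fst (hd (?W 0)) \<in> fst ` set (?W 0)" by simp
      then show ?thesis using hd[of 0] True unfolding involves_iff by (metis minus_zero)
    next
      case False
      then show ?thesis using W[of "- m"] by (intro exI[of _ "(x, - m)"]) (auto simp: involves_iff)
    qed
    then obtain z where z: "involves (?W (- m)) z" "snd z \<noteq> 0" by blast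
    have "free_on (UNIV \<times> {0}) {?W (- m)}" using z by (intro edge[of z]) auto
    then have "eqv {} ?u []" using triv zero by (auto simp: free_on_def)
    from eqv_rename[OF this, of fst] show "eqv {} u []"
      by (simp add: rename_rename rename_ident[of UNIV u "fst \<circ> (\<lambda>z. (z, 0 :: int))"] word_on_def)
  qed
qed

text \<open>The generators are natural numbers so that the induction can absorb the passage to the
  generators \<open>(x, j)\<close>, which is coded back into \<open>nat\<close>.\<close>

theorem freiheitssatz:
  fixes w :: "nat letter list"
  assumes "cyclically_reduced w" "involves w t"
  shows "free_on (- {t}) {w}"
  using assms
proof (induction "length w" arbitrary: w t rule: less_induct)
  case less
  show ?case
  proof (cases "exponent_sum t w = 0")
    case False
    then show ?thesis by (rule free_on_nonzero_exponent_sum)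
  next
    case True
    have "\<not> word_on {t} w"
      using one_generator_trivial[OF _ True] reduced_trivial[of w] less.prems
      by (auto simp: cyclically_reduced_def involves_def)
    from ex_rotation[OF less.prems(2) this] obtain u v a p y where
      uv: "w = u @ v" "v @ u = a # p @ [y]" "fst a = t" "fst y \<noteq> t" by blast
    let ?w = "v @ u"
    have "free_on (- {t}) {?w}"
    proof (rule free_on_zero_exponent_sum[OF _ uv(2-4)])
      show "cyclically_reduced ?w" using less.prems(1) uv(1) cyclically_reduced_rotate by blast
      show "exponent_sum t ?w = 0" using True uv(1) by simp
      fix s z
      let ?W = "rewrite t s ?w"
      assume c: "cyclically_reduced ?W" and i: "involves ?W z"
      let ?f = "to_nat :: nat \<times> int \<Rightarrow> nat"
      \<comment> \<open>Rewriting deletes every occurrence of \<open>t\<close>, and there is at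
        least one.\<close>
      have "length (rename ?f ?W) < length w"
        using length_rewrite_less[of ?w t s] less.prems(2) uv(1)
        by (simp add: involves_def add.commute disj_commute disj_left_commute)
      then have "free_on (- {?f z}) {rename ?f ?W}"
        using c i by (intro less.hyps) (auto simp: cyclically_reduced_rename involves_rename)
      then show "free_on (- {z}) {?W}" by (rule free_on_rename_imp[rotated]) simp
    qed
    moreover have "eqv {?w} x []" if "eqv {w} x []" for x
      using that
    proof (rule eqv_relators)
      fix r assume "r \<in> {w}"
      then show "eqv {?w} r []"
        using eqv_rotate[of "{?w}" v u] eqv_rel[of ?w "{?w}" "[]" "[]"] uv(1) by simp
    qed
    ultimately show ?thesis by (auto simp: free_on_def)
  qed
qed

section \<open>Chains of shifted one-relator groups\<close>

text \<open>What the chain argument takes from the relator: its two extreme Magnus subgroups are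
  free and their intersection is not exceptional, expressed by words instead of cosets.\<close>

locale nonexceptional_relator =
  fixes k :: nat and w :: "nat letter list"
  assumes k: "k \<ge> 1"
    and word: "word_on {0..k} w"
    and free_initial: "free_on {0..<k} {w}"
    and free_final: "free_on {1..k} {w}"
    and nonexceptional: "\<And>u v. word_on {0..<k} u \<Longrightarrow> word_on {1..k} v \<Longrightarrow> eqv {w} u v \<Longrightarrow>
      \<exists>z. word_on {1..<k} z \<and> eqv {w} u z"
begin

definition block :: "int \<Rightarrow> int set" where "block s = {s..s + int k}"

text \<open>The cycle of relators is unrolled along the integers; subscripts are reduced mod
  \<open>n\<close> only at the end.\<close>

definition relator :: "int \<Rightarrow> int letter list" where "relator s = rename (\<lambda>i. int i + s) w"

lemma image_shift: "(\<lambda>i. int i + s) ` {a..b} = {int a + s..int b + s}"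
  "(\<lambda>i. int i + s) ` {a..<b} = {int a + s..<int b + s}"
proof -
  have "x \<in> (\<lambda>i. int i + s) ` A" if "0 \<le> x - s" "nat (x - s) \<in> A" for x A
    using that by (intro image_eqI[of _ _ "nat (x - s)"]) auto
  then show "(\<lambda>i. int i + s) ` {a..b} = {int a + s..int b + s}"
    "(\<lambda>i. int i + s) ` {a..<b} = {int a + s..<int b + s}"
    by (fastforce simp: nat_le_iff nat_less_iff le_nat_iff)+
qed

lemma free_relator:
  assumes "Z \<subseteq> {0..k}" "free_on Z {w}"
  shows "free_on ((\<lambda>i. int i + s) ` Z) {relator s}"
  using free_on_rename[of "\<lambda>i. int i + s" "{0..k}" "{w}" Z] assms word
  by (simp add: relator_def inj_on_def)

lemma free_relator_final: "free_on {s + 1..s + int k} {relator s}"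
proof -
  have "free_on ((\<lambda>i. int i + s) ` {1..k}) {relator s}"
    by (rule free_relator[OF _ free_final]) auto
  then show ?thesis unfolding image_shift by (simp add: add.commute)
qed

lemma free_relator_initial: "free_on {s..<s + int k} {relator s}"
proof -
  have "free_on ((\<lambda>i. int i + s) ` {0..<k}) {relator s}"
    by (rule free_relator[OF _ free_initial]) auto
  then show ?thesis unfolding image_shift by (simp add: add.commute)
qed

lemma block_Int: "block c \<inter> block (c + 1) = {c + 1..c + int k}"
  by (auto simp: block_def)

sublocale amalgam_chain block "\<lambda>s. {relator s}"
proof
  show "word_on (block s) r" if "r \<in> {relator s}" for r s
  proof -
    have "word_on ((\<lambda>i. int i + s) -` block s) w"
      by (rule word_on_mono[OF word]) (auto simp: block_def)
    then show ?thesis using that by (simp add: relator_def word_on_rename)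
  qed
  show "block s \<inter> block t \<subseteq> block c \<inter> block (c + 1)" if "s \<le> c" "c < t" for s c t
    using that by (auto simp: block_def)
  show "free_on (block c \<inter> block (c + 1)) {relator c}" for c
    using free_relator_final by (simp add: block_Int)
  have "{c + 1..c + int k} = {c + 1..<c + 1 + int k}" for c by auto
  then show "free_on (block c \<inter> block (c + 1)) {relator (c + 1)}" for c
    using free_relator_initial[of "c + 1"] by (simp add: block_Int)
qed

lemma gens_eq: "a \<le> b \<Longrightarrow> gens a b = {a..b + int k}"
proof
  assume "a \<le> b"
  show "{a..b + int k} \<subseteq> gens a b"
  proof
    fix x assume x: "x \<in> {a..b + int k}"
    then have "min x b \<in> {a..b}" "x \<in> block (min x b)" using \<open>a \<le> b\<close> by (auto simp: block_def)
    then show "x \<in> gens a b" by blast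
  qed
qed (auto simp: block_def)

text \<open>Both \<open>u\<close> and \<open>z\<close> are words in the initial generators, which
  are free in the one-relator group, so their equality there is equality in the free group.\<close>

lemma nonexceptional_relator:
  assumes "word_on {s..<s + int k} u" "word_on {s + 1..s + int k} v" "eqv {relator s} u v"
  shows "\<exists>z. word_on {s + 1..<s + int k} z \<and> eqv {} u z"
proof -
  let ?f = "\<lambda>i. int i + s" and ?g = "\<lambda>i. nat (i - s)"
  have fg: "rename ?f (rename ?g x) = x" if "word_on {s..} x" for x
    using rename_ident[OF that, of "?f \<circ> ?g"] by (simp add: rename_rename)
  have u: "word_on {0..<k} (rename ?g u)" unfolding word_on_rename
    by (rule word_on_mono[OF assms(1)]) auto
  have v: "word_on {1..k} (rename ?g v)" unfolding word_on_rename
    by (rule word_on_mono[OF assms(2)]) auto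
  have "rename ?g (relator s) = w"
    using rename_ident[of UNIV w "?g \<circ> ?f"] by (simp add: relator_def rename_rename word_on_def)
  then have "eqv {w} (rename ?g u) (rename ?g v)"
    using eqv_rename[OF assms(3), of ?g] by simp
  from nonexceptional[OF u v this] obtain z where
    z: "word_on {1..<k} z" "eqv {w} (rename ?g u) z" by blast
  have "rename ?f (rename ?g u) = u" by (rule fg) (rule word_on_mono[OF assms(1)], auto)
  then have e: "eqv {relator s} u (rename ?f z)"
    using eqv_rename[OF z(2), of ?f] by (simp add: relator_def)
  have z': "word_on {s + 1..<s + int k} (rename ?f z)" unfolding word_on_rename
    by (rule word_on_mono[OF z(1)]) auto
  have "eqv {} u (rename ?f z)"
    by (rule free_on_eqv[OF free_relator_initial assms(1) word_on_mono[OF z'] e]) auto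
  with z' show ?thesis by blast
qed

section \<open>Intersection and freeness of distant arcs\<close>

lemma chain_split_Z:
  assumes "a \<le> c" "c < b"
  shows "amalgam.Z (\<lambda>l. if l then gens a c else gens (c + 1) b) = {c + 1..c + int k}"
  using gens_Int[OF assms] block_Int amalgam.Z_def[OF chain_split[OF assms]] by simp

text \<open>One relator is removed from the left at each step. Cutting off relator \<open>j\<close>
  puts \<open>z\<close> into the edge group, and the nonexceptional intersection rids it of
  generator \<open>j\<close>. Once all generators below \<open>a + int k\<close> are gone, nothing
  is left of \<open>z\<close>.\<close>

lemma ends_intersect_step:
  assumes "a + int k \<le> b + 1" "a \<le> j"
    and "word_on {j..<a + int k} z" "word_on {b + 1..b + int k} v" "eqv (rels j b) z v"
  shows "eqv {} z []"
  using assms(2,3,5)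
proof (induction "nat (a + int k - j)" arbitrary: j z)
  case 0
  then have "word_on {} z" by simp
  then show ?case by (cases z) auto
next
  case (Suc l)
  then have j: "j < a + int k" "j \<le> b" using assms(1) by auto
  have zj: "word_on {j..<j + int k} z" by (rule word_on_mono[OF Suc.prems(2)]) (use Suc in auto)
  have "\<exists>z'. word_on {j + 1..j + int k} z' \<and> eqv {relator j} z z'"
  \<comment> \<open>With one relator left there is no edge to cut; \<open>v\<close> itself is a word
    in the final generators.\<close>
  proof (cases "j = b")
    case True
    then show ?thesis using assms(4) Suc.prems(3) by auto
  next
    case False
    then have jb: "j \<le> j" "j < b" using j by auto
    note am = chain_split[OF jb]
    have "word_on (gens j j) z" using zj by (rule word_on_mono) (auto simp: block_def)
    moreover have "word_on (gens (j + 1) b) v"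
      using assms(4) by (rule word_on_mono) (use jb in \<open>auto simp: gens_eq\<close>)
    moreover have "rels j b = rels j j \<union> rels (j + 1) b" by (rule rels_split[OF jb])
    ultimately have "amalgam.in_Z (\<lambda>l. if l then gens j j else gens (j + 1) b)
        (\<lambda>l. if l then rels j j else rels (j + 1) b) True z"
      using Suc.prems(3) amalgam.factors_intersect[OF am, of True z v] by simp
    then show ?thesis
      unfolding amalgam.in_Z_def[OF am] chain_split_Z[OF jb] by simp
  qed
  then obtain z' where "word_on {j + 1..j + int k} z'" "eqv {relator j} z z'" by blast
  from nonexceptional_relator[OF zj this] obtain y where
    y: "word_on {j + 1..<j + int k} y" "eqv {} z y" by blast
  \<comment> \<open>The word \<open>y\<close> may use generators from \<open>a + int k\<close> on.
    As \<open>z\<close> has none of them, deleting them does not change the element of the free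
    group.\<close>
  define x where "x = filter (\<lambda>c. fst c \<in> {..<a + int k}) y"
  have "word_on ({j + 1..<j + int k} \<inter> {..<a + int k}) x"
    unfolding x_def by (rule word_on_filter[OF y(1)])
  then have x: "word_on {j + 1..<a + int k} x" by (rule word_on_mono) auto
  have "filter (\<lambda>c. fst c \<in> {..<a + int k}) z = z"
    using Suc.prems(2) by (auto simp: word_on_def filter_id_conv)
  then have zx: "eqv {} z x" using eqv_filter[OF y(2), of "{..<a + int k}"] by (simp add: x_def)
  have "eqv {} x []"
  proof (cases "j = b")
    case True
    then have "word_on {} x" using x assms(1) by simp
    then show ?thesis by (cases x) auto
  next
    case False
    then have jb: "j \<le> j" "j < b" using j by auto
    have "eqv (rels j b) x v"
      using eqv_trans[OF eqv_sym[OF eqv_mono[OF zx]] Suc.prems(3)] by simp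
    then have e: "eqv (rels j b) (x @ word_inv v) []"
      by (simp only: eqv_iff_quotient_trivial[of _ x v])
    have "word_on (gens (j + 1) b) x" using x
      by (rule word_on_mono) (use jb assms(1) in \<open>auto simp: gens_eq\<close>)
    moreover have "word_on (gens (j + 1) b) v"
      using assms(4) by (rule word_on_mono) (use jb in \<open>auto simp: gens_eq\<close>)
    \<comment> \<open>Both words avoid generator \<open>j\<close>, so relator \<open>j\<close> can
      be discarded.\<close>
    ultimately have "eqv (rels (j + 1) b) (x @ word_inv v) []"
      using amalgam.factor_embeds[OF chain_split[OF jb], of False "x @ word_inv v"]
        e rels_split[OF jb] by simp
    then have "eqv (rels (j + 1) b) x v" by (simp only: eqv_iff_quotient_trivial[of _ x v])
    then show ?thesis using Suc x by (intro Suc.hyps(1)[of "j + 1"]) auto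
  qed
  with zx show ?case by (rule eqv_trans)
qed

lemma ends_intersect:
  assumes "a + int k \<le> b + 1"
    and "word_on {a..<a + int k} u" "word_on {b + 1..b + int k} v" "eqv (rels a b) u v"
  shows "eqv {} u []" "eqv {} v []"
proof -
  show u: "eqv {} u []"
    using ends_intersect_step[OF assms(1) order_refl assms(2-4)] .
  have "a \<le> b" using assms(1) k by linarith
  then have "free_on {b + 1..b + int k} (rels a b)"
    by (intro free_on_rels[OF free_relator_final]) (auto simp: block_def)
  moreover have "eqv (rels a b) v []"
    using eqv_trans[OF eqv_sym[OF assms(4)] eqv_mono[OF u]] by simp
  ultimately show "eqv {} v []" using assms(3) by (simp add: free_on_def)
qed

text \<open>By \<open>ends_intersect\<close>, a nontrivial syllable from either arc lies outside the
  middle edge group, so the normal form theorem excludes relations between the arcs.\<close>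

lemma ends_free:
  assumes "a + 2 * int k \<le> b + 1"
  shows "free_on ({a..<a + int k} \<union> {b + 1..b + int k}) (rels a b)"
  unfolding free_on_def
proof (intro allI impI)
  \<comment> \<open>The relators from \<open>a\<close> to \<open>c\<close> are exactly
    \<open>k\<close> in number, and the hypothesis leaves at least as many for the right
    half.\<close>
  define c where "c = a + int k - 1"
  have c: "a \<le> c" "c < b" using assms k by (auto simp: c_def)
  note am = chain_split[OF c]
  let ?X = "\<lambda>l. if l then gens a c else gens (c + 1) b"
  let ?R = "\<lambda>l. if l then rels a c else rels (c + 1) b"
  let ?U = "\<lambda>l. if l then {a..<a + int k} else {b + 1..b + int k}"
  fix u assume u: "word_on ({a..<a + int k} \<union> {b + 1..b + int k}) u" "eqv (rels a b) u []"
  have "word_on (\<Union>l\<in>UNIV. ?U l) u" using u(1) by (simp add: UNIV_bool Un_commute)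
  from ex_alternating[OF this] obtain gs where gs: "alternating gs"
      "\<And>l g. (l, g) \<in> set gs \<Longrightarrow> word_on (?U l) g \<and> \<not> eqv {} g []"
      "eqv {} u (concat (map snd gs))" by auto
  have "\<not> amalgam.in_Z ?X ?R l g" if g: "(l, g) \<in> set gs" for l g
  proof
    assume "amalgam.in_Z ?X ?R l g"
    then obtain z where z: "word_on {c + 1..c + int k} z" "eqv (?R l) g z"
      unfolding amalgam.in_Z_def[OF am] chain_split_Z[OF c] by blast
    have "eqv {} g []"
    proof (cases l)
      case True
      then show ?thesis using gs(2)[OF g] z
        by (intro ends_intersect(1)[of a c g z]) (auto simp: c_def)
    next
      case False
      have "{c + 1..c + int k} = {c + 1..<c + 1 + int k}" by auto
      with False show ?thesis using gs(2)[OF g] z assms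
        by (intro ends_intersect(2)[of "c + 1" b z g]) (auto simp: c_def intro: eqv_sym)
    qed
    then show False using gs(2)[OF g] by blast
  qed
  moreover have "word_on (?X l) g" if g: "(l, g) \<in> set gs" for l g
  proof -
    have "?U l \<subseteq> ?X l" using c assms by (cases l) (auto simp: gens_eq c_def)
    then show ?thesis using gs(2)[OF g] word_on_mono by blast
  qed
  moreover have "eqv (rels a b) (concat (map snd gs)) []"
    using eqv_trans[OF eqv_sym[OF eqv_mono[OF gs(3)]] u(2)] by simp
  ultimately have "gs = []"
    using amalgam.alternating_nontrivial[OF am gs(1)] rels_split[OF c] by auto
  then show "eqv {} u []" using gs(3) by simp
qed

section \<open>Closing the chain to a cycle\<close>

lemma shift_power:
  assumes "k < n"
  shows "(shift n ^^ i) w = rename (\<lambda>x. nat (x mod int n)) (relator (int i))"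
proof (induction i)
  case 0
  have "rename (\<lambda>x. nat (x mod int n)) (relator 0) = rename (\<lambda>x. x mod n) w"
    by (simp add: relator_def rename_rename o_def flip: zmod_int)
  also have "\<dots> = w" using assms by (intro rename_ident[OF word]) auto
  finally show ?case by simp
next
  case (Suc i)
  have "shift n u = rename (\<lambda>x. (x + 1) mod n) u" for u
    by (auto simp: shift_def rename_def map_prod_def)
  moreover have "(nat ((int x + int i) mod int n) + 1) mod n = nat ((int x + (1 + int i)) mod int n)"
    for x
  proof -
    have "nat ((int x + int j) mod int n) = (x + j) mod n" for j
      by (metis nat_int of_nat_add zmod_int)
    from this[of i] this[of "Suc i"] show ?thesis by (simp add: mod_simps)
  qed
  ultimately show ?case using Suc by (simp add: relator_def rename_rename o_def)
qed

theorem generator_infinite_order: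
  assumes n: "4 * k \<le> n" and "eqv ((\<lambda>i. (shift n ^^ i) w) ` {..<n}) (replicate N (0, True)) []"
  shows "N = 0"
proof -
  define g where "g x = nat (x mod int n)" for x
  let ?k = "int k" and ?n = "int n"
  have nk: "0 < n" "k < n" "4 * ?k \<le> ?n" "1 \<le> ?k" using n k by auto
  have g_low: "g x = nat x" if "0 \<le> x" "x < ?n" for x using that by (simp add: g_def)
  have g_high: "g x = nat (x - ?n)" if "?n \<le> x" "x < 2 * ?n" for x
    using that mod_pos_pos_trivial[of "x - ?n" ?n] by (simp add: g_def)
  \<comment> \<open>\<open>?P\<close> has \<open>2 * k\<close> relators and \<open>?Q\<close> has
    \<open>n - 2 * k\<close>; the bound on \<open>n\<close> thus gives both of them the
    \<open>2 * k\<close> relators that \<open>ends_free\<close> requires.\<close>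
  let ?P = "rels 0 (2 * ?k - 1)" and ?Q = "rels (2 * ?k) (?n - 1)"
  let ?GP = "{0..3 * ?k - 1}" and ?GQ = "{2 * ?k..?n + ?k - 1}"
  have GP: "gens 0 (2 * ?k - 1) = ?GP" using gens_eq[of 0 "2 * ?k - 1"] nk by simp
  have GQ: "gens (2 * ?k) (?n - 1) = ?GQ" using gens_eq[of "2 * ?k" "?n - 1"] nk by simp
  have injP: "inj_on g ?GP" using nk by (intro inj_onI) (auto simp: g_low)
  \<comment> \<open>The interval \<open>?GQ\<close> runs past \<open>n\<close> but has only
    \<open>n - k\<close> elements, so no residue repeats.\<close>
  have injQ: "inj_on g ?GQ"
  proof (intro inj_onI)
    fix x y assume "x \<in> ?GQ" "y \<in> ?GQ" "g x = g y"
    then show "x = y" using nk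
      by (cases "x < ?n"; cases "y < ?n") (auto simp: g_low g_high)
  qed
  have wP: "word_on ?GP r" if "r \<in> ?P" for r
    using that word_on_mono[OF relators] GP by blast
  have wQ: "word_on ?GQ r" if "r \<in> ?Q" for r
    using that word_on_mono[OF relators] GQ by blast
  \<comment> \<open>The end arcs of \<open>?P\<close> and of \<open>?Q\<close>. They agree mod
    \<open>n\<close> with initial and final arc exchanged: \<open>?Q\<close> begins where
    \<open>?P\<close> ends and wraps around to the beginning of \<open>?P\<close>.\<close>
  let ?E = "{0..<?k} \<union> {2 * ?k..3 * ?k - 1}" and ?E' = "{2 * ?k..<3 * ?k} \<union> {?n..?n + ?k - 1}"
  have lowk: "g ` {0..<?k} = {..<k}"
  proof -
    have "g ` int ` {0..<k} = (\<lambda>i. i) ` {0..<k}"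
      unfolding image_image using nk by (intro image_cong) (auto simp: g_low)
    then show ?thesis by (simp add: image_int_atLeastLessThan lessThan_atLeast0)
  qed
  have EE': "g ` ?E = g ` ?E'"
  proof -
    have "g ` {?n..?n + ?k - 1} = g ` {0..<?k}"
    proof -
      have "{?n..?n + ?k - 1} = (\<lambda>x. x + ?n) ` {0..<?k}" by auto
      moreover have "g ` (\<lambda>x. x + ?n) ` A = g ` A" for A by (simp add: image_image g_def)
      ultimately show ?thesis by (simp only:)
    qed
    moreover have "{2 * ?k..3 * ?k - 1} = {2 * ?k..<3 * ?k}" by auto
    ultimately show ?thesis by (simp add: image_Un Un_commute)
  qed
  \<comment> \<open>No other generators are shared, so freeness on the arcs is freeness on the whole
    amalgamated subgroup.\<close>
  have int: "g ` ?GP \<inter> g ` ?GQ \<subseteq> g ` ?E"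
  proof
    fix x assume "x \<in> g ` ?GP \<inter> g ` ?GQ"
    then obtain p q where pq: "p \<in> ?GP" "q \<in> ?GQ" "x = g p" "x = g q" by blast
    have "p = (if q < ?n then q else q - ?n)"
      using pq nk by (auto simp: g_low g_high)
    then have "p \<in> ?E" using pq nk by (auto split: if_splits)
    then show "x \<in> g ` ?E" using pq by blast
  qed
  have freeP: "free_on (g ` ?E) (rename g ` ?P)"
    using ends_free[of 0 "2 * ?k - 1"] nk by (intro free_on_rename[OF injP wP]) auto
  have freeQ: "free_on (g ` ?E) (rename g ` ?Q)"
    unfolding EE' using ends_free[of "2 * ?k" "?n - 1"] nk
    by (intro free_on_rename[OF injQ wQ]) (auto simp: algebra_simps)
  have am: "amalgam (\<lambda>l. if l then g ` ?GP else g ` ?GQ)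
      (\<lambda>l. if l then rename g ` ?P else rename g ` ?Q)"
  proof
    show "word_on (if l then g ` ?GP else g ` ?GQ) r"
      if r: "r \<in> (if l then rename g ` ?P else rename g ` ?Q)" for r l
    proof -
      obtain s where s: "r = rename g s" "s \<in> (if l then ?P else ?Q)"
        using r by (cases l) auto
      then have "word_on (if l then ?GP else ?GQ) s" using wP wQ by (cases l) auto
      then show ?thesis unfolding s(1) word_on_rename
        by (rule word_on_mono) auto
    qed
    show "free_on ((if True then g ` ?GP else g ` ?GQ) \<inter> (if False then g ` ?GP else g ` ?GQ))
        (if l then rename g ` ?P else rename g ` ?Q)" for l
      using free_on_mono[OF freeP int] free_on_mono[OF freeQ int] by simp
  qed
  have "(\<lambda>i. (shift n ^^ i) w) ` {..<n} = rename g ` relator ` {0..<?n}"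
  proof -
    have "{0..<?n} = int ` {0..<n}" by (simp add: image_int_atLeastLessThan)
    then have "rename g ` relator ` {0..<?n} = (\<lambda>i. rename g (relator (int i))) ` {..<n}"
      by (simp only: image_image lessThan_atLeast0)
    then show ?thesis using shift_power[OF nk(2)] by (simp add: g_def[abs_def])
  qed
  also have "{0..<?n} = {0..2 * ?k - 1} \<union> {2 * ?k..?n - 1}" using nk by auto
  also have "rename g ` relator ` \<dots> = rename g ` ?P \<union> rename g ` ?Q"
    by (auto simp: image_Un)
  finally have rels: "eqv (rename g ` ?P \<union> rename g ` ?Q) (replicate N (0, True)) []"
    using assms(2) by simp
  have "0 \<in> g ` {0..<?k}" using lowk k by auto
  then have x0: "word_on (g ` {0..<?k}) (replicate N (0, True))" by (auto simp: word_on_def)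
  have "word_on (g ` ?GP) (replicate N (0, True))"
    by (rule word_on_mono[OF x0]) (intro image_mono, use nk in auto)
  then have "eqv (rename g ` ?P) (replicate N (0, True)) []"
    using amalgam.factor_embeds[OF am, of True] rels by simp
  then have "eqv {} (replicate N (0, True)) ([] :: nat letter list)"
    using freeP word_on_mono[OF x0, of "g ` ?E"] by (auto simp: free_on_def)
  then have "exponent_sum 0 (replicate N (0 :: nat, True)) = 0"
    using exponent_sum_eqv[of "{}" _ "[]" 0] by simp
  moreover have "exponent_sum 0 (replicate N (0 :: nat, True)) = int N" by (induction N) auto
  ultimately show "N = 0" by simp
qed

end

section \<open>Words and presented groups\<close>

lemma eqv_foldr_push: "eqv R (foldr push u v) (u @ v)"
proof (induction u)
  case (Cons a u)
  have "eqv R (push a x) (a # x)" for x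
    using eqv_sym[OF eqv_cancel[of R "[]" a]] by (cases x) auto
  from eqv_trans[OF this eqv_Cons[OF Cons]] show ?case by simp
qed simp

lemma free_group_simps:
  "x \<in> carrier (free_group X) \<longleftrightarrow> reduced x \<and> word_on X x"
  "x \<otimes>\<^bsub>free_group X\<^esub> y = foldr push x y" "\<one>\<^bsub>free_group X\<^esub> = []"
  by (auto simp: free_group_def)

context
  fixes X :: "'a set" and R :: "'a letter list set"
  assumes relators: "R \<subseteq> carrier (free_group X)"
begin

abbreviation closure :: "'a letter list set" where "closure \<equiv> normal_closure (free_group X) R"

lemma closure_normal: "closure \<lhd> free_group X"
  by (rule group.normal_closure_normal[OF group_free_group relators])

lemma relators_closure: "r \<in> R \<Longrightarrow> r \<in> closure"
  by (auto simp: normal_closure_def)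

text \<open>The reduced words on \<open>X\<close> that are trivial for \<open>eqv R\<close> form a
  normal subgroup containing \<open>R\<close>.\<close>

lemma closure_eqv:
  assumes "x \<in> closure"
  shows "eqv R x []"
proof -
  interpret F: group "free_group X" by (rule group_free_group)
  let ?N = "{x \<in> carrier (free_group X). eqv R x []}"
  have inv: "eqv S (inv\<^bsub>free_group X\<^esub> x) (word_inv x)" if "x \<in> carrier (free_group X)" for x S
  proof -
    have "foldr push (inv\<^bsub>free_group X\<^esub> x) x = []"
      using F.l_inv[OF that] by (simp add: free_group_simps)
    then have "eqv S (inv\<^bsub>free_group X\<^esub> x @ x) []"
      using eqv_sym[OF eqv_foldr_push[of S "inv\<^bsub>free_group X\<^esub> x" x]] by simp
    then show ?thesis by (simp add: eqv_cancel_right)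
  qed
  have mult: "eqv R (x \<otimes>\<^bsub>free_group X\<^esub> y) z" if "eqv R (x @ y) z" for x y z
    using eqv_trans[OF eqv_foldr_push that] by (simp add: free_group_simps)
  have inv1: "eqv R (word_inv x) []" if "eqv R x []" for x
    using eqv_cancel_left[of R x "[]" "[]"] that eqv_sym by fastforce
  have "subgroup ?N (free_group X)"
  proof (rule F.subgroupI)
    show "?N \<noteq> {}" by (auto simp: free_group_simps intro!: exI[of _ "[]"])
    show "inv\<^bsub>free_group X\<^esub> x \<in> ?N" if "x \<in> ?N" for x
      using that eqv_trans[OF inv inv1] by simp
    show "x \<otimes>\<^bsub>free_group X\<^esub> y \<in> ?N" if "x \<in> ?N" "y \<in> ?N" for x y
      using that mult[of x y "[]"] eqv_append[of R x "[]" y "[]"] by simp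
  qed auto
  moreover have "g \<otimes>\<^bsub>free_group X\<^esub> x \<otimes>\<^bsub>free_group X\<^esub> inv\<^bsub>free_group X\<^esub> g \<in> ?N"
    if g: "g \<in> carrier (free_group X)" and x: "x \<in> ?N" for g x
  proof -
    have "eqv R (g @ x) g" using eqv_append[of R g g x "[]"] x by simp
    then have "eqv R ((g \<otimes>\<^bsub>free_group X\<^esub> x) @ inv\<^bsub>free_group X\<^esub> g) (g @ word_inv g)"
      using mult inv[OF g] by (intro eqv_append) auto
    with eqv_word_inv_right have "eqv R ((g \<otimes>\<^bsub>free_group X\<^esub> x) @ inv\<^bsub>free_group X\<^esub> g) []"
      using eqv_trans by blast
    then show ?thesis using g x mult by simp
  qed
  ultimately have "?N \<lhd> free_group X" by (simp add: F.normal_inv_iff)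
  moreover have "R \<subseteq> ?N" using relators eqv_rel[of _ R "[]" "[]"] by auto
  ultimately show ?thesis using assms by (auto simp: normal_closure_def)
qed

text \<open>The word is reduced first because derivations of \<open>eqv\<close> pass through words
  outside the carrier of the free group.\<close>

definition word_class :: "'a letter list \<Rightarrow> 'a letter list set" where
  "word_class u = closure #>\<^bsub>free_group X\<^esub> foldr push u []"

lemma reduced_form_carrier: "word_on X u \<Longrightarrow> foldr push u [] \<in> carrier (free_group X)"
  by (simp add: free_group_simps reduced_foldr_push word_on_foldr_push)

lemma word_class_carrier: "word_on X u \<Longrightarrow> word_class u \<in> carrier (presented_group X R)"
  unfolding word_class_def presented_group_def FactGroup_def
  by (auto simp: RCOSETS_def dest: reduced_form_carrier)

lemma word_class_append:
  assumes "word_on X u" "word_on X v"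
  shows "word_class (u @ v) = word_class u \<otimes>\<^bsub>presented_group X R\<^esub> word_class v"
proof -
  have "foldr push (u @ v) [] = foldr push u [] \<otimes>\<^bsub>free_group X\<^esub> foldr push v []"
    using foldr_push_assoc[of "[]" "foldr push v []" u] by (simp add: free_group_simps reduced_foldr_push)
  then show ?thesis
    using normal.rcos_sum[OF closure_normal reduced_form_carrier[OF assms(1)] reduced_form_carrier[OF assms(2)]]
    by (simp add: word_class_def presented_group_def FactGroup_def)
qed

lemma word_class_closure: "x \<in> closure \<Longrightarrow> word_class x = closure"
proof -
  assume x: "x \<in> closure"
  interpret N: normal closure "free_group X" by (rule closure_normal)
  have "foldr push x [] = x"
    using N.mem_carrier[OF x] by (simp add: free_group_simps foldr_push_Nil)
  then show ?thesis using N.rcos_const[OF group_free_group x] by (simp add: word_class_def)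
qed

lemma one_presented_group: "\<one>\<^bsub>presented_group X R\<^esub> = closure" "word_class [] = closure"
proof -
  interpret N: normal closure "free_group X" by (rule closure_normal)
  show "word_class [] = closure"
    using word_class_closure[of "[]"] subgroup.one_closed[OF normal_imp_subgroup[OF closure_normal]]
    by (simp add: free_group_simps)
qed (simp add: presented_group_def FactGroup_def)

text \<open>A derivation may use letters outside \<open>X\<close>; deleting them at every step
  leaves a derivation over \<open>X\<close>, because all relators are words on
  \<open>X\<close>.\<close>

lemma eqv_imp_word_class_eq:
  assumes "eqv R u v" "word_on X u" "word_on X v"
  shows "word_class u = word_class v"
proof -
  interpret G: group "presented_group X R" by (rule group_presented_group[OF relators])
  let ?f = "filter (\<lambda>a. fst a \<in> X)"
  have f: "word_on X (?f u)" for u :: "'a letter list" by (auto simp: word_on_def)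
  have fX: "?f u = u" if "word_on X u" for u using that by (auto simp: word_on_def filter_id_conv)
  have "word_class (?f u) = word_class (?f v)" using assms(1)
  proof (induction rule: eqv.induct)
    case (eqv_cancel u a v)
    have "push a (push (inv_letter a) (foldr push v [])) = foldr push v []" for v
      using push_inv[of "foldr push v []" "inv_letter a"] reduced_foldr_push[of "[]" v] by simp
    then show ?case by (simp add: word_class_def)
  next
    case (eqv_rel r u v)
    then have "?f r = r" "word_class r = \<one>\<^bsub>presented_group X R\<^esub>" "word_on X r"
      using relators fX word_class_closure[OF relators_closure] one_presented_group
      by (auto simp: free_group_simps)
    then show ?case using f word_class_carrier[OF f] by (simp add: word_class_append)
  qed simp_all
  then show ?thesis using fX assms by simp
qed

lemma word_class_eq_imp_eqv:
  assumes "word_class u = word_class v" "word_on X u" "word_on X v"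
  shows "eqv R u v"
proof -
  interpret N: normal closure "free_group X" by (rule closure_normal)
  have "foldr push u [] \<in> word_class u" unfolding word_class_def
    by (rule N.rcos_self[OF reduced_form_carrier[OF assms(2)] N.is_subgroup])
  then have "foldr push u [] \<in> word_class v" by (simp only: assms(1))
  then obtain x where x: "x \<in> closure" "foldr push u [] = foldr push x (foldr push v [])"
    by (auto simp: word_class_def r_coset_def free_group_simps)
  have "eqv R u (foldr push u [])" using eqv_sym[OF eqv_foldr_push[of R u "[]"]] by simp
  also have "eqv R \<dots> (x @ foldr push v [])" unfolding x(2) by (rule eqv_foldr_push)
  also have "eqv R \<dots> ([] @ v)"
    using eqv_foldr_push[of R v "[]"] by (intro eqv_append closure_eqv x) simp
  finally show ?thesis by simp
qed

lemma presented_subgroup_eq: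
  assumes "Y \<subseteq> X"
  shows "presented_subgroup X R Y = word_class ` {u. word_on Y u}"
proof
  interpret G: group "presented_group X R" by (rule group_presented_group[OF relators])
  have X: "word_on X u" if "word_on Y u" for u using that assms word_on_mono by blast
  have gen: "presented_gen X R x = word_class [(x, True)]" for x
    by (simp add: presented_gen_def word_class_def)
  have class_inv: "inv\<^bsub>presented_group X R\<^esub> word_class [(x, True)] = word_class [(x, False)]"
    if "x \<in> X" for x
  proof (rule G.inv_equality)
    have "word_class [(x, False)] \<otimes>\<^bsub>presented_group X R\<^esub> word_class [(x, True)] =
      word_class ([(x, False)] @ [(x, True)])"
      using that by (intro word_class_append[symmetric]) auto
    also have "\<dots> = word_class []" by (simp add: word_class_def inv_letter_def)
    finally show "word_class [(x, False)] \<otimes>\<^bsub>presented_group X R\<^esub> word_class [(x, True)] =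
      \<one>\<^bsub>presented_group X R\<^esub>" by (simp add: one_presented_group)
  qed (use that word_class_carrier in auto)
  show "presented_subgroup X R Y \<subseteq> word_class ` {u. word_on Y u}"
  proof
    fix x assume "x \<in> presented_subgroup X R Y"
    then show "x \<in> word_class ` {u. word_on Y u}"
      unfolding presented_subgroup_def
    proof (induction rule: generate.induct)
      case one
      show ?case by (rule image_eqI[of _ _ "[]"]) (simp_all add: one_presented_group)
    next
      case (incl h)
      then obtain x where "x \<in> Y" "h = word_class [(x, True)]" by (auto simp: gen)
      then show ?case by (intro image_eqI[of _ _ "[(x, True)]"]) auto
    next
      case (inv h)
      then obtain x where "x \<in> Y" "h = word_class [(x, True)]" by (auto simp: gen)
      then show ?case using class_inv assms by (intro image_eqI[of _ _ "[(x, False)]"]) auto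
    next
      case (eng g h)
      then obtain u v where "word_on Y u" "word_on Y v" "g = word_class u" "h = word_class v" by auto
      then show ?case using X word_class_append by (intro image_eqI[of _ _ "u @ v"]) auto
    qed
  qed
  show "word_class ` {u. word_on Y u} \<subseteq> presented_subgroup X R Y"
  proof
    fix x assume "x \<in> word_class ` {u. word_on Y u}"
    then obtain u where u: "word_on Y u" "x = word_class u" by auto
    from u(1) have "word_class u \<in> presented_subgroup X R Y"
      unfolding presented_subgroup_def
    proof (induction u)
      case Nil
      show ?case using generate.one one_presented_group by metis
    next
      case (Cons a u)
      have "word_class [a] \<in> generate (presented_group X R) (presented_gen X R ` Y)"
      proof (cases "snd a")
        case True
        then show ?thesis using Cons.prems gen[of "fst a"]
          by (cases a) (auto intro!: generate.incl)
      next
        case False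
        then have "word_class [a] = inv\<^bsub>presented_group X R\<^esub> presented_gen X R (fst a)"
          using Cons.prems gen class_inv assms by (cases a) auto
        then show ?thesis using Cons.prems by (auto intro!: generate.inv)
      qed
      moreover have "word_class (a # u) = word_class [a] \<otimes>\<^bsub>presented_group X R\<^esub> word_class u"
        using word_class_append[of "[a]" u] Cons.prems X[of u] assms by auto
      ultimately show ?case using Cons by (auto intro: generate.eng)
    qed
    then show "x \<in> presented_subgroup X R Y" by (simp add: u)
  qed
qed

lemma infinite_presented_group:
  assumes "x \<in> X" "\<And>N. eqv R (replicate N (x, True)) [] \<Longrightarrow> N = 0"
  shows "infinite (carrier (presented_group X R))"
proof -
  let ?c = "\<lambda>N :: nat. word_class (replicate N (x, True))"
  have X: "word_on X (replicate N (x, True))" for N using assms(1) by (auto simp: word_on_def)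
  have "N \<ge> M" if "?c M = ?c N" for M N
  proof (rule ccontr)
    assume "\<not> N \<ge> M"
    then have "replicate M (x, True) = replicate N (x, True) @ replicate (M - N) (x, True)"
      by (simp flip: replicate_add)
    then have "eqv R (replicate N (x, True) @ replicate (M - N) (x, True)) (replicate N (x, True))"
      using word_class_eq_imp_eqv[OF that X X] by simp
    then have "eqv R (replicate (M - N) (x, True)) []"
      unfolding eqv_cancel_left using eqv_word_inv_left eqv_trans by blast
    with assms(2) show False using \<open>\<not> N \<ge> M\<close> by fastforce
  qed
  then have "inj ?c" by (auto intro!: injI antisym)
  moreover have "range ?c \<subseteq> carrier (presented_group X R)" using word_class_carrier X by blast
  ultimately show ?thesis 
    by (meson finite_imageD finite_subset infinite_UNIV_nat)
qed

end

text \<open>The common class of \<open>u\<close> and \<open>v\<close> lies in both Magnus subgroups,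
  hence in the subgroup of the common generators, where \<open>z\<close> is a word for it.\<close>

lemma not_exceptional_intersection_imp:
  assumes R: "word_on X r" "reduced r" and Y: "Y\<^sub>1 \<subseteq> X" "Y\<^sub>2 \<subseteq> X"
    and ne: "\<not> exceptional_intersection X r Y\<^sub>1 Y\<^sub>2"
    and uv: "word_on Y\<^sub>1 u" "word_on Y\<^sub>2 v" "eqv {r} u v"
  shows "\<exists>z. word_on (Y\<^sub>1 \<inter> Y\<^sub>2) z \<and> eqv {r} u z"
proof -
  have r: "{r} \<subseteq> carrier (free_group X)" using R by (simp add: free_group_simps)
  note eq = presented_subgroup_eq[OF r]
  have "word_class X {r} u = word_class X {r} v"
    using uv Y word_on_mono by (intro eqv_imp_word_class_eq[OF r]) blast+
  then have "word_class X {r} u \<in> presented_subgroup X {r} Y\<^sub>1 \<inter> presented_subgroup X {r} Y\<^sub>2"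
    using uv by (auto simp: eq[OF Y(1)] eq[OF Y(2)])
  then have "word_class X {r} u \<in> presented_subgroup X {r} (Y\<^sub>1 \<inter> Y\<^sub>2)"
    using ne unfolding exceptional_intersection_def by blast
  then obtain z where z: "word_on (Y\<^sub>1 \<inter> Y\<^sub>2) z" "word_class X {r} u = word_class X {r} z"
    using eq[of "Y\<^sub>1 \<inter> Y\<^sub>2"] Y by auto
  have "eqv {r} u z"
    using z uv(1) Y word_on_mono by (intro word_class_eq_imp_eqv[OF r]) blast+
  with z show ?thesis by blast
qed

theorem corollary1p2:
  fixes k n :: nat and w :: "nat letter list"
  assumes "k \<ge> 1"
    and "word_on {0..k} w"
    and "cyclically_reduced w"
    and "involves w 0" and "involves w k"
    and "\<not> exceptional_intersection {0..k} w {0..<k} {1..k}"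
    and "n \<ge> 4 * k"
  shows "infinite (carrier (cyc_pres_group n w))"
proof -
  have red: "reduced w" using assms(3) by (simp add: cyclically_reduced_def)
  interpret nonexceptional_relator k w
  proof
    show "free_on {0..<k} {w}"
      by (rule free_on_mono[OF freiheitssatz[OF assms(3,5)]]) auto
    show "free_on {1..k} {w}"
      by (rule free_on_mono[OF freiheitssatz[OF assms(3,4)]]) auto
    have sub: "{0..<k} \<subseteq> {0..k}" "{1..k} \<subseteq> {0..k}" by auto
    have "{0..<k} \<inter> {1..k} = {1..<k}" by auto
    then show "\<exists>z. word_on {1..<k} z \<and> eqv {w} u z"
      if "word_on {0..<k} u" "word_on {1..k} v" "eqv {w} u v" for u v
      using not_exceptional_intersection_imp[OF assms(2) red sub assms(6) that] by simp
  qed (use assms in auto)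
  have kn: "k < n" using assms(1,7) by linarith
  have "(shift n ^^ i) w \<in> carrier (free_group {..<n})" for i
  proof (induction i)
    case 0
    have "word_on {..<n} w" by (rule word_on_mono[OF assms(2)]) (use kn in auto)
    then show ?case using red by (simp add: free_group_simps)
  next
    case (Suc i)
    then show ?case using shift_iso[of n] by (auto simp: iso_def hom_def)
  qed
  then have "(\<lambda>i. (shift n ^^ i) w) ` {..<n} \<subseteq> carrier (free_group {..<n})" by blast
  then show ?thesis unfolding cyc_pres_group_def
    using kn generator_infinite_order[OF assms(7)]
    by (intro infinite_presented_group[of _ _ 0]) auto
qed

end
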